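(* Let $V_{1}, \ldots, V_{n}$ be a finite collection of closed subsets of the sphere $S^{2}$, each homeomorphic to the closed two-dimensional disk. Suppose that the set $\bigcup_{i=1}^{n} \operatorname{Int} V_{i}$ is connected and that $S^{2} \setminus \bigcup_{i=1}^{n} V_{i} \neq \emptyset$. Let $W$ be a connected component of the set $S^{2} \setminus \bigcup_{i=1}^{n} V_{i}$. Then the closure $\operatorname{Cl} W$ is homeomorphic to the closed two-dimensional disk.
   Context: $\operatorname{Int} V_i$ denotes the interior of $V_i$ in $S^2$ and $\operatorname{Cl} W$ the closure of $W$ in $S^2$. *)

theory Defs
  imports "HOL-Analysis.Analysis"
begin

abbreviation S2 :: "(real^3) set" where
  "S2 \<equiv> sphere 0 1"

abbreviation S2top :: "(real^3) topology" where
  "S2top \<equiv> subtopology euclidean S2"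

end

theory Submission
  imports Defs "HOL-Complex_Analysis.Complex_Analysis"
begin

text \<open>
  Let \<open>U\<close> be the union of the discs. A stereographic projection from a point inside \<open>V 1\<close> turns \<open>W\<close>
  into a bounded complementary component of a closed set \<open>K\<close> in the plane. The set \<open>K\<close> is connected,
  no point cuts it (deleting finitely many points from the connected open set of interiors leaves
  a connected dense part of \<open>U\<close>), and it is connected im kleinen, being a finite union of closed
  locally connected sets. Hence \<open>W\<close> is simply connected, and it suffices to extend a Riemann map
  \<open>g\<close> from the unit disc to a homeomorphism of the closures, as in Caratheodory's theorem.

  For the existence of boundary limits of \<open>g\<close>, a neighbourhood of a boundary point is unrolled to a
  horizontal strip; since the image has finite area, there are arbitrarily short crosscuts, whose ends
  can be joined by small connected subsets of \<open>K\<close>, and Janiszewski's theorem shows that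
  they cut off small regions. If two boundary points had the same image \<open>a\<close>, the images of the
  two radii would form a Jordan curve meeting \<open>K\<close> only in \<open>a\<close>. As \<open>K - {a}\<close> is connected, it lies on
  one side, so the boundary values equal \<open>a\<close> on a whole arc, which is impossible.
\<close>

section \<open>The area of a conformal image\<close>

text \<open>Areas of images are computed in \<open>real^2\<close>, iterated integrals in
  \<open>real \<times> real\<close>. Identifying the coordinates carries boxes to boxes of equal
  content, so \<open>has_integral_twiddle\<close> applies with factor 1.\<close>

lemma integral_real2_prod:
  fixes f :: "real^2 \<Rightarrow> real"
  assumes "continuous_on (cbox (vector [a, c]) (vector [b, d])) f"
  shows "integral (cbox (a, c) (b, d)) (\<lambda>p. f (vector [fst p, snd p]))
       = integral (cbox (vector [a, c]) (vector [b, d])) f"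
proof -
  let ?g = "\<lambda>p::real\<times>real. vector [fst p, snd p] :: real^2"
  let ?h = "\<lambda>v::real^2. (v$1, v$2)"
  have hg: "?h (?g p) = p" and gh: "?g (?h v) = v" for p v
    by (auto simp: vec_eq_iff forall_2)
  have lin: "linear ?g" by (simp add: linear_iff vec_eq_iff forall_2)
  have cont: "continuous (at p) ?g" for p
    using linear_continuous_at[OF linear_conv_bounded_linear[THEN iffD1, OF lin]] by simp
  have gbox: "?g ` cbox u v = cbox (?g u) (?g v)" for u v
  proof -
    have "w \<in> ?g ` cbox u v" if "w \<in> cbox (?g u) (?g v)" for w
      using that gh[of w] by (cases u; cases v; intro image_eqI[of _ _ "?h w"]) (auto simp: cbox_def Basis_prod_def Basis_vec_def inner_axis forall_2)
    moreover have "?g p \<in> cbox (?g u) (?g v)" if "p \<in> cbox u v" for p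
      using that by (cases p; cases u; cases v) (auto simp: cbox_def Basis_prod_def Basis_vec_def inner_axis forall_2)
    ultimately show ?thesis by blast
  qed
  have hbox: "?h ` cbox u v = cbox (?h u) (?h v)" for u v
  proof -
    have "cbox u v = ?g ` cbox (?h u) (?h v)" using gbox[of "?h u" "?h v"] gh by simp
    then show ?thesis using hg by (metis (mono_tags, lifting) image_image image_ident image_cong)
  qed
  have cnt: "measure lborel (?g ` cbox u v) = 1 * measure lborel (cbox u v)" for u v
  proof -
    obtain u1 u2 v1 v2 where uv: "u = (u1,u2)" "v = (v1,v2)" by (cases u; cases v)
    show ?thesis
    proof (cases "cbox u v = {}")
      case False
      then have "cbox (?g u) (?g v) \<noteq> {}" using gbox[of u v] by blast
      then have "measure lborel (cbox (?g u) (?g v)) = (v1 - u1) * (v2 - u2)"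
        using content_cbox_cart[of "?g u" "?g v"] uv by (simp add: UNIV_2)
      moreover have "measure lborel (cbox u v) = (v1 - u1) * (v2 - u2)"
        using False unfolding uv content_Pair by (auto simp: cbox_Pair_eq)
      ultimately show ?thesis using gbox by simp
    qed simp
  qed
  have "(f has_integral (integral (cbox (vector [a, c]) (vector [b, d])) f)) (cbox (vector [a, c]) (vector [b, d]))"
    using integrable_continuous[OF assms] by blast
  then have "((\<lambda>p. f (?g p)) has_integral (1 / 1) *\<^sub>R (integral (cbox (vector [a, c]) (vector [b, d])) f))
      (?h ` cbox (vector [a, c]) (vector [b, d]))"
  proof (rule has_integral_twiddle[of 1, rotated -1])
    show "\<exists>w z. ?g ` cbox u v = cbox w z" for u v using gbox by blast
    show "\<exists>w z. ?h ` cbox u v = cbox w z" for u v using hbox by blast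
  qed (use hg gh cont cnt in auto)
  then show ?thesis unfolding hbox by (simp add: integral_unique)
qed

text \<open>The Jacobian determinant of a holomorphic map is the squared modulus of its derivative,
  so by injectivity the integral is the area of the image of the rectangle, which lies in a square
  of side \<open>2 * M\<close>.\<close>

lemma area_of_image_bound:
  fixes h :: "complex \<Rightarrow> complex"
  assumes hol: "h holomorphic_on S" and "open S" and inj: "inj_on h S"
    and bd: "\<And>z. z \<in> S \<Longrightarrow> norm (h z) \<le> M"
    and sub: "\<And>x y. \<lbrakk>x \<in> {a..b}; y \<in> {c..d}\<rbrakk> \<Longrightarrow> Complex x y \<in> S" and "0 \<le> M"
  shows "integral (cbox (a, c) (b, d)) (\<lambda>(x,y). (norm (deriv h (Complex x y)))\<^sup>2) \<le> 4 * M\<^sup>2"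
proof -
  define T where "T = (\<lambda>z. vector [Re z, Im z] :: real^2)"
  define E where "E = (\<lambda>v::real^2. Complex (v$1) (v$2))"
  define R :: "(real^2) set" where "R = cbox (vector [a, c]) (vector [b, d])"
  have ES: "E v \<in> S" if "v \<in> R" for v
    using that sub[of "v$1" "v$2"] by (auto simp: R_def E_def mem_box_cart forall_2)
  have "linear T" "linear E"
    by (simp_all add: linear_iff T_def E_def vec_eq_iff forall_2 complex_eq_iff)
  then have bl: "bounded_linear T" "bounded_linear E" by (simp_all add: linear_conv_bounded_linear)
  let ?H = "\<lambda>v. T (h (E v))"
  let ?H' = "\<lambda>v w. T (deriv h (E v) * E w)"
  have der: "(?H has_derivative ?H' v) (at v within R)" if "v \<in> R" for v
  proof -
    have "(h has_derivative (*) (deriv h (E v))) (at (E v))"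
      using holomorphic_derivI[OF hol \<open>open S\<close> ES[OF that]] by (simp add: has_field_derivative_def)
    then have "((\<lambda>v. h (E v)) has_derivative (\<lambda>w. deriv h (E v) * E w)) (at v within R)"
      using has_derivative_compose[OF bounded_linear_imp_has_derivative[OF bl(2)]] by blast
    then show ?thesis by (rule bounded_linear.has_derivative[OF bl(1)])
  qed
  have det: "\<bar>det (matrix (?H' v))\<bar> = (norm (deriv h (E v)))\<^sup>2" for v
    unfolding det_2 matrix_def
    by (simp add: T_def E_def axis_def cmod_power2 flip: power2_eq_square)
  have contE: "continuous_on R E" using bl(2) linear_continuous_on by blast
  have conth: "continuous_on R (\<lambda>v. h (E v))"
    using continuous_on_compose2[OF holomorphic_on_imp_continuous_on[OF hol] contE] ES by blast
  have contH: "continuous_on R ?H"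
    using continuous_on_compose2[OF linear_continuous_on[OF bl(1), of UNIV] conth] by simp
  have contD: "continuous_on R (\<lambda>v. (norm (deriv h (E v)))\<^sup>2)"
    using continuous_on_compose2[OF holomorphic_on_imp_continuous_on[OF holomorphic_deriv[OF hol \<open>open S\<close>]] contE] ES
    by (intro continuous_intros) blast
  have "inj_on ?H R"
  proof (rule inj_onI)
    fix v w assume vw: "v \<in> R" "w \<in> R" "?H v = ?H w"
    then have "h (E v) = h (E w)" by (simp add: T_def vec_eq_iff forall_2 complex_eq_iff)
    then have "E v = E w" using inj ES vw by (auto dest: inj_onD)
    then show "v = w" by (simp add: E_def vec_eq_iff forall_2)
  qed
  have intg: "(\<lambda>v. \<bar>det (matrix (?H' v))\<bar>) integrable_on R"
    unfolding det using contD unfolding R_def by (rule integrable_continuous)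
  have "integral R (\<lambda>v. (norm (deriv h (E v)))\<^sup>2) = measure lebesgue (?H ` R)"
    using measure_differentiable_image_eq[of R ?H ?H', OF _ der \<open>inj_on ?H R\<close> intg]
    unfolding det by (simp add: R_def)
  also have "\<dots> \<le> measure lebesgue (cbox (vector [-M,-M]) (vector [M,M]) :: (real^2) set)"
  proof (rule measure_mono_fmeasurable)
    show "?H ` R \<subseteq> cbox (vector [-M,-M]) (vector [M,M])"
    proof clarify
      fix v assume "v \<in> R"
      then have "norm (h (E v)) \<le> M" using ES bd by blast
      then have "\<bar>Re (h (E v))\<bar> \<le> M" "\<bar>Im (h (E v))\<bar> \<le> M"
        using abs_Re_le_cmod abs_Im_le_cmod order_trans by blast+
      then show "?H v \<in> cbox (vector [-M,-M]) (vector [M,M])"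
        by (auto simp: mem_box_cart forall_2 T_def)
    qed
    have "compact (?H ` R)" using contH by (intro compact_continuous_image) (auto simp: R_def)
    then show "?H ` R \<in> sets lebesgue" using lmeasurable_compact by blast
  qed (auto intro: lmeasurable_cbox)
  also have "\<dots> = 4 * M\<^sup>2"
  proof -
    have "0 \<in> cbox (vector [-M,-M]) (vector [M,M] :: real^2)"
      using \<open>0 \<le> M\<close> by (simp add: mem_box_cart forall_2)
    then show ?thesis
      using content_cbox_cart[of "vector [-M,-M]::real^2" "vector [M,M]"]
      by (auto simp: UNIV_2 power2_eq_square)
  qed
  finally have "integral R (\<lambda>v. (norm (deriv h (E v)))\<^sup>2) \<le> 4 * M\<^sup>2" .
  moreover have "integral (cbox (a, c) (b, d)) (\<lambda>(x,y). (norm (deriv h (Complex x y)))\<^sup>2)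
      = integral R (\<lambda>v. (norm (deriv h (E v)))\<^sup>2)"
    using integral_real2_prod[OF contD[unfolded R_def]]
    by (simp add: R_def E_def case_prod_unfold)
  ultimately show ?thesis by simp
qed

section \<open>Short crosscuts in a strip\<close>

text \<open>The width \<open>pi\<close> is chosen so that \<open>exp\<close> maps the strip
  bijectively onto the right half-plane, from which a Moebius map leads to the disc. The left end of
  the strip then stands for a single boundary point.\<close>

definition strip :: "complex set" where
  "strip = {u. \<bar>Im u\<bar> < pi / 2}"

lemma open_strip: "open strip"
proof -
  have "strip = {u. - (pi/2) < Im u} \<inter> {u. Im u < pi/2}" by (auto simp: strip_def)
  then show ?thesis by (metis open_Int open_halfspace_Im_gt open_halfspace_Im_lt)
qed

text \<open>This is the length-area method: the area integral over an interval of length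
  \<open>L\<close> is at most \<open>4 * M\<^sup>2\<close>, so some vertical segment carries at most
  \<open>e\<^sup>2 / (2 * pi)\<close> of it, which makes its image short. The condition on
  \<open>L\<close> does not involve \<open>c\<close>, so that \<open>c\<close> can later tend to
  \<open>pi / 2\<close>.\<close>

lemma short_segment_image:
  assumes hol: "h holomorphic_on strip" and inj: "inj_on h strip"
    and bd: "\<And>z. z \<in> strip \<Longrightarrow> norm (h z) \<le> M" and "0 \<le> M"
    and "0 < c" "c < pi/2" "0 < e" and L: "L * e\<^sup>2 > 8 * pi * M\<^sup>2" "0 < L"
  shows "\<exists>s\<in>{a..a+L}. \<forall>x\<in>{-c..c}. \<forall>y\<in>{-c..c}. norm (h (Complex s x) - h (Complex s y)) \<le> e"
proof -
  define D where "D = (\<lambda>s t. norm (deriv h (Complex s t)))"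
  have inS: "Complex s t \<in> strip" if "t \<in> {-c..c}" for s t
    using that \<open>c < pi/2\<close> by (auto simp: strip_def)
  have contC: "continuous_on T (\<lambda>p. Complex (fst p) (snd p))" for T :: "(real \<times> real) set"
    by (simp add: complex_eq_iff Complex_eq continuous_intros)
  have contD2: "continuous_on (cbox (a,-c) (a+L,c)) (\<lambda>(s,t). (D s t)\<^sup>2)"
  proof -
    have "continuous_on (cbox (a,-c) (a+L,c)) (\<lambda>p. deriv h (Complex (fst p) (snd p)))"
      by (rule continuous_on_compose2[OF holomorphic_on_imp_continuous_on[OF holomorphic_deriv[OF hol open_strip]] contC])
        (auto intro!: inS simp: cbox_Pair_eq)
    then show ?thesis unfolding D_def case_prod_unfold by (intro continuous_intros)
  qed
  define I2 where "I2 = (\<lambda>s. integral {-c..c} (\<lambda>t. (D s t)\<^sup>2))"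
  have area: "integral {a..a+L} I2 \<le> 4 * M\<^sup>2"
  proof -
    have "integral {a..a+L} I2 = integral (cbox (a,-c) (a+L,c)) (\<lambda>(s,t). (D s t)\<^sup>2)"
      using integral_prod_continuous[OF contD2] by (simp add: I2_def)
    also have "\<dots> \<le> 4 * M\<^sup>2"
      unfolding D_def by (rule area_of_image_bound[OF hol open_strip inj bd]) (use inS \<open>0 \<le> M\<close> in auto)
    finally show ?thesis .
  qed
  have contDs: "continuous_on {-c..c} (\<lambda>t. D s t)" for s
  proof -
    have "continuous_on {-c..c} (\<lambda>t. Complex s t)" by (simp add: Complex_eq continuous_intros)
    then have "continuous_on {-c..c} (\<lambda>t. deriv h (Complex s t))"
      by (rule continuous_on_compose2[OF holomorphic_on_imp_continuous_on[OF holomorphic_deriv[OF hol open_strip]]])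
        (auto intro!: inS)
    then show ?thesis unfolding D_def by (intro continuous_intros)
  qed
  have contI2: "continuous_on {a..a+L} I2"
  proof -
    have "continuous_on (cbox a (a+L) \<times> cbox (-c) c) (\<lambda>(s,t). (D s t)\<^sup>2)"
      using contD2 by (simp add: cbox_Pair_eq)
    from integral_continuous_on_param[OF this] show ?thesis by (simp add: I2_def)
  qed
  have "\<exists>s\<in>{a..a+L}. I2 s \<le> e\<^sup>2 / (2 * pi)"
  proof (rule ccontr)
    assume "\<not> ?thesis"
    then have "integral {a..a+L} (\<lambda>s. e\<^sup>2 / (2 * pi)) \<le> integral {a..a+L} I2"
      using contI2 by (intro integral_le integrable_continuous_interval) (auto simp: not_le intro: less_imp_le)
    then have "L * (e\<^sup>2 / (2 * pi)) \<le> 4 * M\<^sup>2" using area \<open>0 < L\<close> by simp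
    then show False using L by (simp add: field_simps)
  qed
  then obtain s where s: "s \<in> {a..a+L}" "I2 s \<le> e\<^sup>2 / (2 * pi)" by blast
  have *: "norm (h (Complex s x) - h (Complex s y)) \<le> e" if xy: "-c \<le> y" "y \<le> x" "x \<le> c" for x y
  proof -
    have sub: "{y..x} \<subseteq> {-c..c}" using xy by auto
    have "((\<lambda>t. \<i> * deriv h (Complex s t)) has_integral (h (Complex s x) - h (Complex s y))) {y..x}"
    proof (rule fundamental_theorem_of_calculus[OF xy(2)])
      fix t assume "t \<in> {y..x}"
      then have "Complex s t \<in> strip" using inS sub by blast
      then have "(h has_field_derivative deriv h (Complex s t)) (at (Complex s t))"
        using holomorphic_derivI[OF hol open_strip] by blast
      moreover have "((\<lambda>t. Complex s t) has_vector_derivative \<i>) (at t within {y..x})"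
        unfolding Complex_eq by (auto intro!: derivative_eq_intros simp: has_vector_derivative_def scaleR_conv_of_real mult.commute)
      ultimately have "((h \<circ> Complex s) has_vector_derivative \<i> * deriv h (Complex s t)) (at t within {y..x})"
        by (metis field_vector_diff_chain_within has_field_derivative_at_within)
      then show "((\<lambda>t. h (Complex s t)) has_vector_derivative \<i> * deriv h (Complex s t)) (at t within {y..x})"
        by (simp add: o_def)
    qed
    then have eq: "h (Complex s x) - h (Complex s y) = integral {y..x} (\<lambda>t. \<i> * deriv h (Complex s t))"
      and ii: "(\<lambda>t. \<i> * deriv h (Complex s t)) integrable_on {y..x}"
      by (metis integral_unique, metis has_integral_integrable)
    \<comment> \<open>AM-GM with weight \<open>e / pi\<close> replaces the Cauchy-Schwarz inequality.\<close>
    have amgm: "D s t \<le> (pi / (2 * e)) * (D s t)\<^sup>2 + e / (2 * pi)" for t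
    proof -
      have "0 \<le> (pi * D s t - e)\<^sup>2" by simp
      then have "2 * pi * e * D s t \<le> pi\<^sup>2 * (D s t)\<^sup>2 + e\<^sup>2" by (simp add: power2_eq_square algebra_simps)
      then have "D s t \<le> (pi\<^sup>2 * (D s t)\<^sup>2 + e\<^sup>2) / (2 * pi * e)"
        using \<open>0 < e\<close> by (simp add: pos_le_divide_eq mult.commute)
      also have "\<dots> = (pi / (2 * e)) * (D s t)\<^sup>2 + e / (2 * pi)"
        using \<open>0 < e\<close> by (simp add: add_divide_distrib power2_eq_square)
      finally show ?thesis .
    qed
    have "norm (h (Complex s x) - h (Complex s y)) \<le> integral {y..x} (\<lambda>t. D s t)"
      unfolding eq
      using integral_norm_bound_integral[OF ii integrable_continuous_interval[OF continuous_on_subset[OF contDs sub]]]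
      by (auto simp: D_def norm_mult)
    also have "\<dots> \<le> integral {-c..c} (\<lambda>t. D s t)"
      by (intro integral_subset_le sub integrable_continuous_interval continuous_on_subset[OF contDs]) (auto simp: D_def)
    also have "\<dots> \<le> integral {-c..c} (\<lambda>t. (pi / (2 * e)) * (D s t)\<^sup>2 + e / (2 * pi))"
      using amgm \<open>0 < e\<close> by (intro integral_le integrable_continuous_interval continuous_intros contDs) auto
    also have "\<dots> = (pi / (2 * e)) * I2 s + 2 * c * (e / (2 * pi))"
      using \<open>0 < c\<close> \<open>0 < e\<close> unfolding I2_def
      by (subst integral_add) (auto intro!: integrable_continuous_interval continuous_intros contDs)
    \<comment> \<open>The two summands equal \<open>e / 4\<close> and \<open>e / 2\<close>; the
      second comes from \<open>2 * c < pi\<close>.\<close>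
    also have "\<dots> \<le> (pi / (2 * e)) * (e\<^sup>2 / (2 * pi)) + pi * (e / (2 * pi))"
      using s(2) \<open>0 < e\<close> \<open>c < pi/2\<close> by (intro add_mono mult_left_mono mult_right_mono) auto
    also have "\<dots> \<le> e" using \<open>0 < e\<close> by (simp add: field_simps power2_eq_square)
    finally show ?thesis .
  qed
  show ?thesis
  proof (intro bexI[OF _ s(1)] ballI)
    fix x y assume "x \<in> {-c..c}" "y \<in> {-c..c}"
    then show "norm (h (Complex s x) - h (Complex s y)) \<le> e"
      using *[of y x] *[of x y] by (cases "y \<le> x") (auto simp: norm_minus_commute)
  qed
qed

text \<open>The length-area estimate only reaches closed segments inside the strip. Segments of
  half-length \<open>c n\<close> exhausting the vertical lines give abscissas \<open>s n\<close> in
  one fixed compact interval, and by continuity of \<open>h\<close> a limit of a subsequence works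
  for an entire vertical line of the strip.\<close>

lemma short_crosscut:
  assumes hol: "h holomorphic_on strip" and inj: "inj_on h strip"
    and bd: "bounded (h ` strip)" and "0 < e"
  shows "\<exists>s\<le>N. \<forall>u\<in>strip. \<forall>v\<in>strip. Re u = s \<longrightarrow> Re v = s \<longrightarrow> norm (h u - h v) \<le> e"
proof -
  obtain M where "0 < M" and M: "\<And>z. z \<in> strip \<Longrightarrow> norm (h z) \<le> M"
    using bd by (metis bounded_pos imageI)
  \<comment> \<open>This length depends on \<open>M\<close> and \<open>e\<close> only; the summand 1
    makes the required inequality strict.\<close>
  define L where "L = 8 * pi * M\<^sup>2 / e\<^sup>2 + 1"
  have L: "L * e\<^sup>2 > 8 * pi * M\<^sup>2" "0 < L"
  proof -
    have "L * e\<^sup>2 = 8 * pi * M\<^sup>2 + e\<^sup>2" using \<open>0 < e\<close> by (simp add: L_def distrib_right)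
    then show "L * e\<^sup>2 > 8 * pi * M\<^sup>2" using \<open>0 < e\<close> by simp
    have "0 \<le> 8 * pi * M\<^sup>2 / e\<^sup>2" by simp
    then show "0 < L" unfolding L_def by linarith
  qed
  define c where "c = (\<lambda>n. pi/2 - 1 / real (Suc n))"
  have c: "0 < c n" "c n < pi/2" for n
  proof -
    have "1 / real (Suc n) \<le> 1" by simp
    then show "0 < c n" using pi_gt3 unfolding c_def by linarith
    show "c n < pi/2" by (simp add: c_def)
  qed
  have "\<exists>s\<in>{N-L..N}. \<forall>x\<in>{-c n..c n}. \<forall>y\<in>{-c n..c n}. norm (h (Complex s x) - h (Complex s y)) \<le> e" for n
    using short_segment_image[OF hol inj M _ c(1)[of n] c(2) \<open>0 < e\<close> L, of "N - L"] \<open>0 < M\<close> by auto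
  then obtain s where s: "\<And>n. s n \<in> {N-L..N}"
    and se: "\<And>n x y. \<lbrakk>x \<in> {-c n..c n}; y \<in> {-c n..c n}\<rbrakk> \<Longrightarrow> norm (h (Complex (s n) x) - h (Complex (s n) y)) \<le> e"
    by metis
  have "seq_compact {N-L..N}" by (simp add: compact_imp_seq_compact)
  then obtain s0 r where s0: "s0 \<in> {N-L..N}" and r: "strict_mono r" "(s \<circ> r) \<longlonglongrightarrow> s0"
    using s by (metis seq_compactE)
  have "norm (h u - h v) \<le> e" if uv: "u \<in> strip" "v \<in> strip" "Re u = s0" "Re v = s0" for u v
  proof -
    have lim: "(\<lambda>n. h (Complex (s (r n)) (Im w))) \<longlonglongrightarrow> h w" if "w \<in> strip" "Re w = s0" for w
    proof -
      have "(\<lambda>n. Complex (s (r n)) (Im w)) \<longlonglongrightarrow> Complex s0 (Im w)"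
        using r(2) by (intro tendsto_Complex) (auto simp: o_def)
      moreover have "Complex s0 (Im w) = w" using that by (simp add: complex_eq_iff)
      moreover have "isCont h w"
        using holomorphic_on_imp_continuous_on[OF hol] open_strip that(1) continuous_on_eq_continuous_at by blast
      ultimately show ?thesis using isCont_tendsto_compose[of w h] by simp
    qed
    have ev: "eventually (\<lambda>n. y \<in> {-c (r n)..c (r n)}) sequentially" if "\<bar>y\<bar> < pi/2" for y
    proof -
      have "c \<longlonglongrightarrow> pi/2 - 0" unfolding c_def
        by (intro tendsto_diff tendsto_const) (use LIMSEQ_inverse_real_of_nat in \<open>simp add: inverse_eq_divide\<close>)
      then have "(c \<circ> r) \<longlonglongrightarrow> pi/2" using LIMSEQ_subseq_LIMSEQ r(1) by fastforce
      then have "eventually (\<lambda>n. \<bar>y\<bar> < c (r n)) sequentially"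
        using order_tendstoD(1) that by (fastforce simp: o_def)
      then show ?thesis by eventually_elim auto
    qed
    have "eventually (\<lambda>n. norm (h (Complex (s (r n)) (Im u)) - h (Complex (s (r n)) (Im v))) \<le> e) sequentially"
      using eventually_conj[OF ev[of "Im u"] ev[of "Im v"]] uv(1,2) unfolding strip_def
      by (auto elim!: eventually_mono intro!: se)
    moreover have "(\<lambda>n. norm (h (Complex (s (r n)) (Im u)) - h (Complex (s (r n)) (Im v)))) \<longlonglongrightarrow> norm (h u - h v)"
      by (intro tendsto_intros lim uv)
    ultimately show ?thesis
      by (intro tendsto_upperbound[OF _ _ trivial_limit_sequentially])
  qed
  then show ?thesis using s0 by auto
qed

section \<open>Boundary limits of the conformal map\<close>

text \<open>The connected set may depend on \<open>x\<close> and need not be open in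
  \<open>K\<close>, so that the property can be checked piece by piece on a finite union.\<close>

definition connected_im_kleinen :: "'a::metric_space set \<Rightarrow> 'a \<Rightarrow> bool" where
  "connected_im_kleinen K a \<longleftrightarrow>
     (\<forall>e>0. \<exists>d>0. \<forall>x\<in>K \<inter> ball a d. \<exists>C. connected C \<and> C \<subseteq> K \<inter> ball a e \<and> a \<in> C \<and> x \<in> C)"

text \<open>The images of suitable vertical lines shrink and accumulate at a boundary point
  \<open>a\<close>. Such a crosscut, a small part of \<open>K\<close> near \<open>a\<close> and
  \<open>K\<close> itself separate the images of the two half-strips. A point of the left one
  outside a small disc around \<open>a\<close> could still be joined to \<open>h 0\<close> around
  that disc, which Janiszewski's theorem turns into a contradiction.\<close>

lemma conformal_strip_limit:
  assumes hol: "h holomorphic_on strip" and inj: "inj_on h strip"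
    and bd: "bounded (h ` strip)" and "closed K"
    and fr: "frontier (h ` strip) \<subseteq> K" and disj: "h ` strip \<inter> K = {}"
    and ik: "\<And>a. a \<in> frontier (h ` strip) \<Longrightarrow> connected_im_kleinen K a"
  shows "\<exists>a. \<forall>e>0. \<exists>N. \<forall>u\<in>strip. Re u < N \<longrightarrow> dist (h u) a \<le> e"
proof -
  define W where "W = h ` strip"
  have openimg: "open (h ` T)" if "open T" "T \<subseteq> strip" for T
    using open_mapping_thm3[OF holomorphic_on_subset[OF hol that(2)] that(1) inj_on_subset[OF inj that(2)]] .
  have "open W" using openimg open_strip by (simp add: W_def)
  have zero: "0 \<in> strip" by (simp add: strip_def)
  have reS: "complex_of_real x \<in> strip" for x by (simp add: strip_def)
  have "connected strip"
  proof -
    have "strip = {u. - (pi/2) < Im u} \<inter> {u. Im u < pi/2}" by (auto simp: strip_def)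
    then show ?thesis
      by (metis convex_Int convex_connected convex_halfspace_Im_gt convex_halfspace_Im_lt)
  qed
  then have "connected W" unfolding W_def
    using connected_continuous_image holomorphic_on_imp_continuous_on[OF hol] by blast
  have "\<exists>s\<le>- real n. \<forall>u\<in>strip. \<forall>v\<in>strip. Re u = s \<longrightarrow> Re v = s \<longrightarrow> norm (h u - h v) \<le> 1 / real (Suc n)" for n
    by (rule short_crosscut[OF hol inj bd]) simp
  then obtain s where sn: "\<And>n. s n \<le> - real n"
    and osc: "\<And>n u v. \<lbrakk>u \<in> strip; v \<in> strip; Re u = s n; Re v = s n\<rbrakk> \<Longrightarrow> norm (h u - h v) \<le> 1 / real (Suc n)"
    by metis
  define p where "p = (\<lambda>n. h (complex_of_real (s n)))"
  have pW: "p n \<in> W" for n using reS by (auto simp: p_def W_def)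
  have "compact (closure W)" using bd by (simp add: W_def)
  moreover have "p n \<in> closure W" for n using pW closure_subset by blast
  ultimately obtain a r where a: "a \<in> closure W" and r: "strict_mono r" "(p \<circ> r) \<longlonglongrightarrow> a"
    unfolding compact_def by metis
  \<comment> \<open>All values near \<open>h u0\<close> come from points with real part above
    \<open>Re u0 - 1\<close>, whereas the points defining \<open>p\<close> have real parts tending
    to minus infinity.\<close>
  have "a \<notin> W"
  proof
    assume "a \<in> W"
    then obtain u0 where u0: "u0 \<in> strip" "a = h u0" by (auto simp: W_def)
    define T where "T = strip \<inter> {u. Re u0 - 1 < Re u}"
    have "open T" by (simp add: T_def open_Int open_strip open_halfspace_Re_gt)
    then have "open (h ` T)" using openimg by (auto simp: T_def)
    moreover have "a \<in> h ` T" using u0 by (auto simp: T_def)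
    ultimately have "eventually (\<lambda>n. (p \<circ> r) n \<in> h ` T) sequentially"
      using r(2) topological_tendstoD by metis
    moreover have "eventually (\<lambda>n. real n > 1 - Re u0) sequentially"
      using filterlim_real_sequentially filterlim_at_top_dense by metis
    ultimately have "eventually (\<lambda>n. False) sequentially"
    proof eventually_elim
      case (elim n)
      then obtain u where u: "u \<in> T" "h (complex_of_real (s (r n))) = h u" by (auto simp: p_def)
      then have "u = complex_of_real (s (r n))"
        using inj reS by (auto simp: T_def dest: inj_onD)
      then have "Re u0 - 1 < s (r n)" using u by (auto simp: T_def)
      moreover have "s (r n) \<le> - real n" using sn[of "r n"] seq_suble[OF r(1), of n] by linarith
      ultimately show False using elim by linarith
    qed
    then show False by simp
  qed
  then have afr: "a \<in> frontier W" using a \<open>open W\<close> by (simp add: frontier_def interior_open)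
  have "\<exists>N. \<forall>u\<in>strip. Re u < N \<longrightarrow> dist (h u) a \<le> e" if "0 < e" for e
  proof -
    \<comment> \<open>Keeping \<open>e'\<close> below the distance from \<open>a\<close> to
      \<open>h 0\<close> leaves \<open>h 0\<close> outside the disc, as a reference point to the
      right of the crosscut.\<close>
    define e' where "e' = min e (dist (h 0) a / 2)"
    have "h 0 \<noteq> a" using \<open>a \<notin> W\<close> zero by (auto simp: W_def)
    then have e': "0 < e'" "e' \<le> e" "e' < dist (h 0) a" using \<open>0 < e\<close> by (auto simp: e'_def min_def)
    obtain d0 where d0: "0 < d0"
      "\<And>x. x \<in> K \<inter> ball a d0 \<Longrightarrow> \<exists>C. connected C \<and> C \<subseteq> K \<inter> ball a e' \<and> a \<in> C \<and> x \<in> C"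
      using ik[unfolded connected_im_kleinen_def] afr e'(1) unfolding W_def by metis
    define d where "d = min d0 e'"
    have d: "0 < d" "d \<le> d0" "d \<le> e'" using d0 e' by (auto simp: d_def)
    \<comment> \<open>One third of \<open>d\<close> bounds the distance from \<open>p m\<close> to
      \<open>a\<close>, another the oscillation along the crosscut; the last third is a margin that
      survives taking the closure.\<close>
    have "eventually (\<lambda>n. dist ((p \<circ> r) n) a < d / 3) sequentially"
      using r(2) d(1) tendstoD by (metis divide_pos_pos zero_less_numeral)
    moreover have "eventually (\<lambda>n. real n > 3 / d) sequentially"
      using filterlim_real_sequentially filterlim_at_top_dense by metis
    ultimately have "eventually (\<lambda>n. dist ((p \<circ> r) n) a < d / 3 \<and> real n > 3 / d) sequentially"
      by eventually_elim auto
    then obtain n where n: "dist (p (r n)) a < d / 3" "real n > 3 / d"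
      unfolding eventually_sequentially by auto
    define m where "m = r n"
    have m: "dist (p m) a < d / 3" "real m > 3 / d" "s m < 0"
    proof -
      show *: "real m > 3 / d" using n(2) seq_suble[OF r(1), of n] by (simp add: m_def)
      have "3 / d > 0" using d by simp
      then show "s m < 0" using sn[of m] * by linarith
    qed (use n in \<open>simp add: m_def\<close>)
    have small: "1 / real (Suc m) \<le> d / 3"
    proof -
      have "3 < real m * d" using m(2) d(1) by (simp add: pos_divide_less_eq)
      then have "3 \<le> real (Suc m) * d" using d(1) by (simp add: distrib_right)
      then have "1 \<le> d / 3 * real (Suc m)" by (simp add: mult.commute)
      then show ?thesis using pos_divide_le_eq[of "real (Suc m)" 1 "d / 3"] by linarith
    qed
    define Q where "Q = closure (h ` {u \<in> strip. Re u = s m})"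
    have QW: "h u \<in> Q" if "u \<in> strip" "Re u = s m" for u
      unfolding Q_def by (rule subsetD[OF closure_subset]) (use that in auto)
    have "h ` {u \<in> strip. Re u = s m} \<subseteq> cball a (2 * d / 3)"
    proof clarify
      fix u assume u: "u \<in> strip" "Re u = s m"
      have "dist (h u) (p m) \<le> 1 / real (Suc m)"
        unfolding p_def dist_norm by (rule osc) (use u reS in auto)
      then have "dist (h u) a \<le> d / 3 + d / 3"
        using m(1) small dist_triangle[of "h u" a "p m"] by linarith
      then show "h u \<in> cball a (2 * d / 3)" by (simp add: dist_commute)
    qed
    then have Qsub: "Q \<subseteq> cball a (2 * d / 3)" unfolding Q_def by (simp add: closure_minimal)
    \<comment> \<open>The small continuum \<open>N\<close> in \<open>K\<close> joins the ends of the crosscut, so that Janiszewski's theorem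
      applies to the crosscut together with \<open>N\<close> on the one hand and \<open>K\<close> on the other.\<close>
    define \<C> where "\<C> = {C. connected C \<and> C \<subseteq> K \<inter> ball a e' \<and> a \<in> C}"
    define N where "N = closure (\<Union>\<C>)"
    have "connected N" unfolding N_def
      by (intro connected_imp_connected_closure connected_Union) (auto simp: \<C>_def)
    have NK: "N \<subseteq> K \<inter> cball a e'" unfolding N_def
      by (rule closure_minimal) (use \<open>closed K\<close> in \<open>auto simp: \<C>_def closed_Int\<close>)
    have "Q \<inter> K \<subseteq> N"
    proof
      fix x assume x: "x \<in> Q \<inter> K"
      then have "x \<in> K \<inter> ball a d0" using Qsub d by force
      then obtain C where "C \<in> \<C>" "x \<in> C" using d0(2) unfolding \<C>_def by blast
      then show "x \<in> N" unfolding N_def by (intro subsetD[OF closure_subset]) auto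
    qed
    define S where "S = Q \<union> N"
    have Ssub: "S \<subseteq> cball a e'" using Qsub NK d by (force simp: S_def)
    have "compact S"
      using Ssub by (auto simp: compact_eq_bounded_closed S_def Q_def N_def intro: bounded_subset[OF bounded_cball])
    have "S \<inter> K = N" using \<open>Q \<inter> K \<subseteq> N\<close> NK by (auto simp: S_def)
    have "dist (h u) a \<le> e'" if u: "u \<in> strip" "Re u < s m" for u
    proof (rule ccontr)
      assume far: "\<not> dist (h u) a \<le> e'"
      \<comment> \<open>Off \<open>S\<close> the two points are joined around the disc, off
        \<open>K\<close> they are joined inside \<open>W\<close>.\<close>
      have "connected (- cball a e')"
        by (rule connected_complement_bounded_convex) auto
      then have "connected_component (- S) (h u) (h 0)"
        unfolding connected_component_def using Ssub far e'(3)
        by (intro exI[of _ "- cball a e'"]) (auto simp: dist_commute)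
      moreover have "connected_component (- K) (h u) (h 0)"
        unfolding connected_component_def using \<open>connected W\<close> disj u zero
        by (intro exI[of _ W]) (auto simp: W_def)
      ultimately have "connected_component (- (S \<union> K)) (h u) (h 0)"
        using Janiszewski[OF \<open>compact S\<close> \<open>closed K\<close>] \<open>S \<inter> K = N\<close> \<open>connected N\<close> by metis
      then obtain X where X: "connected X" "X \<subseteq> - (S \<union> K)" "h u \<in> X" "h 0 \<in> X"
        unfolding connected_component_def by blast
      have "X \<subseteq> W"
      proof (rule ccontr)
        assume "\<not> X \<subseteq> W"
        moreover have "h 0 \<in> X \<inter> W" using X(4) zero by (auto simp: W_def)
        ultimately have "X \<inter> frontier W \<noteq> {}"
          using connected_Int_frontier[OF X(1), of W] by blast
        then show False using fr X(2) by (auto simp: W_def)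
      qed
      \<comment> \<open>The image of the crosscut lies in \<open>S\<close>, so \<open>X\<close> is
        covered by the disjoint open images of the two half-strips although it contains a point of
        each.\<close>
      let ?L = "h ` (strip \<inter> {u. Re u < s m})" and ?R = "h ` (strip \<inter> {u. s m < Re u})"
      have "open ?L" "open ?R"
        by (auto intro!: openimg open_Int open_strip open_halfspace_Re_lt open_halfspace_Re_gt)
      moreover have "X \<subseteq> ?L \<union> ?R"
      proof
        fix x assume "x \<in> X"
        then obtain v where v: "v \<in> strip" "x = h v" using \<open>X \<subseteq> W\<close> by (auto simp: W_def)
        then have "Re v \<noteq> s m" using QW \<open>x \<in> X\<close> X(2) by (auto simp: S_def)
        then show "x \<in> ?L \<union> ?R" using v by (cases "Re v < s m") auto
      qed
      moreover have "?L \<inter> ?R \<inter> X = {}"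
        using inj_on_image_Int[OF inj, of "strip \<inter> {u. Re u < s m}" "strip \<inter> {u. s m < Re u}"] by force
      moreover have "?L \<inter> X \<noteq> {}" "?R \<inter> X \<noteq> {}"
      proof -
        have "h u \<in> ?L" "h 0 \<in> ?R" using u zero m(3) by (auto intro!: imageI)
        then show "?L \<inter> X \<noteq> {}" "?R \<inter> X \<noteq> {}" using X(3,4) by blast+
      qed
      ultimately show False using connectedD[OF X(1)] by metis
    qed
    then show ?thesis using e' by (meson order_trans)
  qed
  then show ?thesis by blast
qed
text \<open>The map \<open>m\<close> unrolls the disc at \<open>\<zeta>\<close>: it carries the
  strip onto the disc, with inverse \<open>Ln (k z)\<close>, and \<open>Re u\<close> tending to
  minus infinity means that \<open>m u\<close> tends to \<open>\<zeta>\<close>. The limit in the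
  strip is uniform in \<open>Im u\<close>, hence the limit in the disc is not restricted to any
  direction of approach.\<close>

lemma conformal_disc_limit:
  assumes hol: "g holomorphic_on ball 0 1" and inj: "inj_on g (ball 0 1)"
    and bd: "bounded (g ` ball 0 1)" and "closed K"
    and fr: "frontier (g ` ball 0 1) \<subseteq> K" and disj: "g ` ball 0 1 \<inter> K = {}"
    and ik: "\<And>a. a \<in> frontier (g ` ball 0 1) \<Longrightarrow> connected_im_kleinen K a"
    and \<zeta>: "norm \<zeta> = 1"
  shows "\<exists>a. (g \<longlongrightarrow> a) (at \<zeta> within ball 0 1)"
proof -
  define m where "m = (\<lambda>u. \<zeta> * ((1 - exp u) / (1 + exp u)))"
  define k where "k = (\<lambda>z. (\<zeta> - z) / (\<zeta> + z))"
  have repos: "0 < Re (exp u)" if "u \<in> strip" for u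
    using that by (auto simp: strip_def Re_exp intro!: cos_gt_zero_pi mult_pos_pos)
  have ne: "1 + exp u \<noteq> 0" if "u \<in> strip" for u
    using repos[OF that] by (auto simp: complex_eq_iff)
  have mball: "m u \<in> ball 0 1" if "u \<in> strip" for u
  proof -
    let ?w = "exp u"
    \<comment> \<open>A point of the right half-plane is closer to 1 than to -1.\<close>
    have "(norm (1 - ?w))\<^sup>2 < (norm (1 + ?w))\<^sup>2"
      using repos[OF that] unfolding cmod_power2 by (simp add: power2_eq_square algebra_simps)
    then have "norm (1 - ?w) < norm (1 + ?w)" by (rule power_less_imp_less_base) simp
    then show ?thesis using \<zeta> ne[OF that] by (simp add: m_def norm_mult norm_divide divide_less_eq)
  qed
  have zne: "\<zeta> + z \<noteq> 0" "\<zeta> - z \<noteq> 0" if "z \<in> ball 0 1" for z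
  proof -
    have "norm z < norm \<zeta>" using that \<zeta> by simp
    then show "\<zeta> + z \<noteq> 0" "\<zeta> - z \<noteq> 0" by (auto simp: add_eq_0_iff)
  qed
  have kpos: "0 < Re (k z)" if "z \<in> ball 0 1" for z
  proof -
    have "(norm z)\<^sup>2 < (norm \<zeta>)\<^sup>2" using that \<zeta> by (simp add: power_less_one_iff)
    \<comment> \<open>This real part equals
      \<open>(norm \<zeta>)\<^sup>2 - (norm z)\<^sup>2\<close>.\<close>
    then have "0 < Re ((\<zeta> - z) * cnj (\<zeta> + z))"
      unfolding cmod_power2 by (simp add: power2_eq_square algebra_simps)
    moreover have "k z = ((\<zeta> - z) * cnj (\<zeta> + z)) / of_real ((norm (\<zeta> + z))\<^sup>2)"
      unfolding k_def by (rule complex_div_cnj)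
    ultimately show ?thesis using zne(1)[OF that] by (simp add: Re_divide_of_real)
  qed
  have kne: "k z \<noteq> 0" if "z \<in> ball 0 1" for z using kpos[OF that] by auto
  have kstrip: "Ln (k z) \<in> strip" if "z \<in> ball 0 1" for z
    using kpos[OF that] Re_Ln_pos_lt[OF kne[OF that]] by (simp add: strip_def)
  have mk: "m (Ln (k z)) = z" if "z \<in> ball 0 1" for z
  proof -
    have "\<zeta> \<noteq> 0" using \<zeta> by auto
    have "1 - k z = 2 * z / (\<zeta> + z)" "1 + k z = 2 * \<zeta> / (\<zeta> + z)"
      using zne(1)[OF that] by (simp_all add: k_def field_simps)
    then show ?thesis using zne(1)[OF that] \<open>\<zeta> \<noteq> 0\<close> kne[OF that] by (simp add: m_def)
  qed
  have mimg: "m ` strip = ball 0 1"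
    using mball mk kstrip by (metis (no_types, lifting) image_eqI image_subsetI subsetI subset_antisym)
  have minj: "inj_on m strip"
  proof (rule inj_onI)
    fix u v assume uv: "u \<in> strip" "v \<in> strip" "m u = m v"
    have "\<zeta> \<noteq> 0" using \<zeta> by auto
    then have "(1 - exp u) / (1 + exp u) = (1 - exp v) / (1 + exp v)" using uv(3) unfolding m_def by (metis mult_left_cancel)
    then have "(1 - exp u) * (1 + exp v) = (1 - exp v) * (1 + exp u)"
      using ne uv by (simp add: frac_eq_eq)
    then have "exp u = exp v" by (simp add: algebra_simps)
    moreover have "\<bar>Im u - Im v\<bar> < 2 * pi" using uv by (auto simp: strip_def)
    ultimately show "u = v" by (metis exp_complex_eqI)
  qed
  have mhol: "m holomorphic_on strip"
    unfolding m_def by (intro holomorphic_intros) (use ne in auto)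
  have himg: "(g \<circ> m) ` strip = g ` ball 0 1" using mimg by (metis image_comp)
  have "\<exists>a. \<forall>e>0. \<exists>N. \<forall>u\<in>strip. Re u < N \<longrightarrow> dist ((g \<circ> m) u) a \<le> e"
  proof (rule conformal_strip_limit[OF _ _ _ \<open>closed K\<close>])
    show "g \<circ> m holomorphic_on strip"
      using holomorphic_on_compose[OF mhol] hol mimg by simp
    show "inj_on (g \<circ> m) strip" using comp_inj_on[OF minj] inj mimg by simp
  qed (unfold himg, use assms in auto)
  then obtain a where a: "\<And>e. 0 < e \<Longrightarrow> \<exists>N. \<forall>u\<in>strip. Re u < N \<longrightarrow> dist ((g \<circ> m) u) a \<le> e"
    by blast
  have "(g \<longlongrightarrow> a) (at \<zeta> within ball 0 1)"
  proof (rule tendstoI)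
    fix e :: real assume "0 < e"
    then obtain N where N: "\<forall>u\<in>strip. Re u < N \<longrightarrow> dist ((g \<circ> m) u) a \<le> e/2"
      using a[of "e/2"] by auto
    have "\<zeta> \<noteq> 0" using \<zeta> by auto
    then have "(k \<longlongrightarrow> k \<zeta>) (at \<zeta> within ball 0 1)"
      unfolding k_def by (intro tendsto_intros) auto
    then have "(k \<longlongrightarrow> 0) (at \<zeta> within ball 0 1)" by (simp add: k_def)
    then have "eventually (\<lambda>z. dist (k z) 0 < exp N) (at \<zeta> within ball 0 1)"
      by (rule tendstoD) simp
    moreover have "eventually (\<lambda>z. z \<in> ball 0 1) (at \<zeta> within ball 0 1)"
      by (simp add: eventually_at_filter)
    ultimately show "eventually (\<lambda>z. dist (g z) a < e) (at \<zeta> within ball 0 1)"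
    proof eventually_elim
      case (elim z)
      have "norm (k z) > 0" using kne[OF elim(2)] by simp
      then have "ln (norm (k z)) < ln (exp N)" using elim(1)
        by (subst ln_less_cancel_iff) auto
      then have "Re (Ln (k z)) < N" using kne[OF elim(2)] by simp
      then have "dist (g z) a \<le> e/2" using N kstrip[OF elim(2)] mk[OF elim(2)] by force
      then show ?case using \<open>0 < e\<close> by linarith
    qed
  qed
  then show ?thesis by blast
qed

section \<open>Continuity and injectivity up to the boundary circle\<close>

text \<open>For \<open>y\<close> in \<open>T\<close> near \<open>x\<close>, a point of
  \<open>S\<close> very close to \<open>y\<close> has a value near both \<open>F x\<close> and
  \<open>F y\<close>. Limits taken only from inside the disc thereby give continuity on the closed
  disc.\<close>

lemma continuous_on_if_tendsto_within_dense:
  fixes F :: "'a::metric_space \<Rightarrow> 'b::metric_space"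
  assumes lim: "\<And>x. x \<in> T \<Longrightarrow> (F \<longlongrightarrow> F x) (at x within S)" and "T \<subseteq> closure S"
  shows "continuous_on T F"
  unfolding continuous_on_iff
proof (intro ballI allI impI)
  fix x and e :: real assume "x \<in> T" "0 < e"
  then obtain d where d: "0 < d" "\<And>z. \<lbrakk>z \<in> S; z \<noteq> x; dist z x < d\<rbrakk> \<Longrightarrow> dist (F z) (F x) < e/2"
    using tendstoD[OF lim[OF \<open>x \<in> T\<close>], of "e/2"] by (auto simp: eventually_at)
  have d': "dist (F z) (F x) < e/2" if "z \<in> S" "dist z x < d" for z
    using d(2)[OF that(1) _ that(2)] \<open>0 < e\<close> by (cases "z = x") auto
  have "dist (F y) (F x) < e" if "y \<in> T" "dist y x < d" for y
  proof -
    obtain r where r: "0 < r" "\<And>z. \<lbrakk>z \<in> S; z \<noteq> y; dist z y < r\<rbrakk> \<Longrightarrow> dist (F z) (F y) < e/2"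
      using tendstoD[OF lim[OF \<open>y \<in> T\<close>], of "e/2"] \<open>0 < e\<close> by (auto simp: eventually_at)
    have "0 < min r (d - dist y x)" using r that by simp
    then obtain z where z: "z \<in> S" "dist z y < min r (d - dist y x)"
      using \<open>T \<subseteq> closure S\<close> \<open>y \<in> T\<close> closure_approachable by (metis subsetD)
    have "dist z x < d" using z(2) dist_triangle[of z x y] by simp
    then have 1: "dist (F z) (F x) < e/2" using d' z by blast
    have 2: "dist (F z) (F y) < e/2" using r(2)[of z] z \<open>0 < e\<close> by (cases "z = y") auto
    show ?thesis using 1 2 dist_triangle2[of "F y" "F x" "F z"] by (simp add: dist_commute)
  qed
  then show "\<exists>d>0. \<forall>x'\<in>T. dist x' x < d \<longrightarrow> dist (F x') (F x) < e" using d(1) by blast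
qed
text \<open>Applied with a value \<open>a\<close> that is not attained in the open disc, it shows
  that the boundary values cannot be constantly \<open>a\<close> on any arc.\<close>

lemma holomorphic_const_on_boundary_arc:
  fixes F :: "complex \<Rightarrow> complex"
  assumes cont: "continuous_on (cball 0 1) F" and hol: "F holomorphic_on ball 0 1"
    and "\<alpha> < \<beta>" and arc: "\<And>t. \<lbrakk>\<alpha> < t; t < \<beta>\<rbrakk> \<Longrightarrow> F (cis t) = a"
  shows "F 0 = a"
proof -
  obtain m :: nat where m: "2 * pi / (\<beta> - \<alpha>) < real m" using reals_Archimedean2 by blast
  have "0 < 2 * pi / (\<beta> - \<alpha>)" using \<open>\<alpha> < \<beta>\<close> by simp
  then have "0 < m" using m by linarith
  define \<delta> where "\<delta> = 2 * pi / real m"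
  have \<delta>: "0 < \<delta>" "\<delta> < \<beta> - \<alpha>" "\<delta> * real m = 2 * pi"
    using m \<open>0 < m\<close> \<open>\<alpha> < \<beta>\<close> by (auto simp: \<delta>_def field_simps)
  \<comment> \<open>Finitely many rotations of the arc cover the circle, so the product of the rotated
    functions vanishes on the whole circle.\<close>
  define P where "P = (\<lambda>z. \<Prod>k<m. F (cis (real k * \<delta>) * z) - a)"
  have "P z = 0" if "norm z = 1" for z
  proof -
    have "z = cis (Arg z)"
      using that rcis_cmod_Arg[of z] by (simp add: rcis_def)
    then obtain t where t: "z = cis t" by blast
    \<comment> \<open>The least \<open>j\<close> that carries the angle beyond
      \<open>\<alpha>\<close>; it stays below \<open>\<beta>\<close> because \<open>\<delta>\<close>
      is less than the length of the arc. Reducing \<open>j\<close> modulo \<open>m\<close> only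
      changes the angle by a multiple of \<open>2 * pi\<close>.\<close>
    define j where "j = \<lfloor>(\<alpha> - t) / \<delta>\<rfloor> + 1"
    have "(\<alpha> - t) / \<delta> < of_int j" "of_int j \<le> (\<alpha> - t) / \<delta> + 1" unfolding j_def by linarith+
    then have j: "\<alpha> < t + of_int j * \<delta>" "t + of_int j * \<delta> < \<beta>"
      using \<delta>(1,2) by (auto simp: field_simps)
    define k where "k = nat (j mod int m)"
    have k: "k < m" "int k = j mod int m" using \<open>0 < m\<close> by (auto simp: k_def nat_less_iff)
    have "of_int j = real k + real m * of_int (j div int m)"
    proof -
      have "j = int k + int m * (j div int m)" using k(2) by simp
      then show ?thesis by (metis of_int_add of_int_mult of_int_of_nat_eq)
    qed
    then have "t + of_int j * \<delta> = (real k * \<delta> + t) + 2 * pi * of_int (j div int m)"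
      using \<delta>(3) by (simp add: algebra_simps)
    then have "cis (t + of_int j * \<delta>) = cis (real k * \<delta>) * z"
      by (simp add: t flip: cis_mult)
    then have "F (cis (real k * \<delta>) * z) - a = 0" using arc[OF j] by simp
    then show ?thesis unfolding P_def using k(1) by (auto intro!: prod_zero)
  qed
  moreover have "P holomorphic_on interior (cball 0 1)"
  proof -
    have "(\<lambda>z. F (cis (real k * \<delta>) * z)) holomorphic_on ball 0 1" for k
    proof -
      have "F \<circ> (\<lambda>z. cis (real k * \<delta>) * z) holomorphic_on ball 0 1"
        by (rule holomorphic_on_compose_gen[OF _ hol]) (auto intro!: holomorphic_intros simp: norm_mult)
      then show ?thesis by (simp add: o_def)
    qed
    then show ?thesis unfolding P_def by (auto intro!: holomorphic_intros)
  qed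
  moreover have "continuous_on (closure (cball 0 1)) P"
    unfolding P_def
    by (auto intro!: continuous_intros continuous_on_compose2[OF cont] simp: norm_mult)
  \<comment> \<open>By the maximum modulus principle \<open>P\<close> vanishes at 0, where each
    factor equals \<open>F 0 - a\<close>.\<close>
  ultimately have "norm (P 0) \<le> 0"
    using maximum_modulus_frontier[of P "cball 0 1" 0 0] by auto
  then show ?thesis using \<open>0 < m\<close> by (auto simp: P_def)
qed
text \<open>If both values were \<open>a\<close>, the images of the two radii would form a Jordan
  curve meeting \<open>K\<close> only in \<open>a\<close>, with the connected set
  \<open>K - {a}\<close> on one side. The sector mapped to the other side has an arc of boundary
  points whose values lie in \<open>K\<close> and in the closure of that side, so they all equal
  \<open>a\<close>.\<close>

lemma boundary_values_distinct:
  fixes F :: "complex \<Rightarrow> complex"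
  assumes cont: "continuous_on (cball 0 1) F" and hol: "F holomorphic_on ball 0 1"
    and inj: "inj_on F (ball 0 1)" and disj: "F ` ball 0 1 \<inter> K = {}" and sph: "F ` sphere 0 1 \<subseteq> K"
    and nocut: "\<And>a. a \<in> K \<Longrightarrow> connected (K - {a})"
    and \<beta>: "0 < \<beta>" "\<beta> < 2 * pi"
  shows "F 1 \<noteq> F (cis \<beta>)"
proof
  assume eq: "F 1 = F (cis \<beta>)"
  define a where "a = F 1"
  have aK: "a \<in> K" using sph by (auto simp: a_def)
  have F0: "F 0 \<noteq> a" using disj aK by (metis centre_in_ball disjoint_iff imageI zero_less_one)
  have sphK: "F z \<in> K" if "norm z = 1" for z
    using sph that by (metis image_subset_iff mem_sphere_0)
  have ballK: "F z \<notin> K" if "norm z < 1" for z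
    using disj that by (metis disjoint_iff imageI mem_ball_0)
  define \<gamma> where "\<gamma> = linepath (1::complex) 0 +++ linepath 0 (cis \<beta>)"
  define R where "R = closed_segment (1::complex) 0 \<union> closed_segment 0 (cis \<beta>)"
  have seg1: "z \<in> closed_segment 1 0 \<longleftrightarrow> (\<exists>r. 0 \<le> r \<and> r \<le> 1 \<and> z = of_real r)" for z :: complex
    by (subst closed_segment_commute) (auto simp: closed_segment_def scaleR_conv_of_real)
  have seg2: "z \<in> closed_segment 0 (cis \<beta>) \<longleftrightarrow> (\<exists>r. 0 \<le> r \<and> r \<le> 1 \<and> z = of_real r * cis \<beta>)" for z
    by (auto simp: closed_segment_def scaleR_conv_of_real)
  have piR: "path_image \<gamma> = R" by (simp add: \<gamma>_def R_def path_image_join)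
  have Rcb: "R \<subseteq> cball 0 1" unfolding R_def using seg1 seg2 by (auto simp: norm_mult)
  have Rsph: "z = 1 \<or> z = cis \<beta>" if "z \<in> R" "norm z = 1" for z
    using that unfolding R_def seg1 seg2 Un_iff by (auto simp: norm_mult)
  \<comment> \<open>Uniqueness of the polar angle keeps the two radii apart away from 0 and keeps
    the open sectors off the radii.\<close>
  have polar: "Arg2pi (of_real r * cis t) = t" if "0 < r" "0 \<le> t" "t < 2 * pi" for r t
    by (rule Arg2pi_unique[of r]) (use that in \<open>auto simp: cis_conv_exp\<close>)
  have "arc \<gamma>" unfolding \<gamma>_def
  proof (rule arc_join)
    show "path_image (linepath 1 0) \<inter> path_image (linepath 0 (cis \<beta>)) \<subseteq> {pathstart (linepath 0 (cis \<beta>))}"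
    proof
      fix z assume "z \<in> path_image (linepath 1 0) \<inter> path_image (linepath 0 (cis \<beta>))"
      then obtain r r' where r: "0 \<le> r" "z = of_real r * cis 0" and r': "0 \<le> r'" "z = of_real r' * cis \<beta>"
        using seg1 seg2 by auto
      have "z = 0"
      proof (rule ccontr)
        assume "z \<noteq> 0"
        then have "0 < r" "0 < r'" using r r' by (auto simp: less_le)
        then show False using polar[of r 0] polar[of r' \<beta>] r(2) r'(2) \<beta> by force
      qed
      then show "z \<in> {pathstart (linepath 0 (cis \<beta>))}" by simp
    qed
  qed auto
  then have \<gamma>: "path \<gamma>" "inj_on \<gamma> {0..1}" by (auto simp: arc_def)
  have \<gamma>01: "\<gamma> 0 = 1" "\<gamma> 1 = cis \<beta>"
    by (simp_all add: \<gamma>_def joinpaths_def linepath_def)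
  have \<gamma>R: "\<gamma> x \<in> R" if "x \<in> {0..1}" for x using piR that by (auto simp: path_image_def)
  have end01: "x = 0 \<or> x = 1" if "x \<in> {0..1}" "norm (\<gamma> x) = 1" for x
    using Rsph[OF \<gamma>R[OF that(1)] that(2)] \<gamma>01 inj_onD[OF \<gamma>(2), of x 0] inj_onD[OF \<gamma>(2), of x 1] that(1) by auto
  define c where "c = F \<circ> \<gamma>"
  define J where "J = path_image c"
  have J: "J = F ` R" by (simp add: J_def c_def path_image_compose piR)
  have "path c" unfolding c_def
    by (rule path_continuous_image[OF \<gamma>(1)]) (use cont continuous_on_subset Rcb piR in auto)
  have "simple_path c"
    unfolding simple_path_def loop_free_def
  proof (intro conjI ballI impI \<open>path c\<close>)
    fix x y :: real assume xy: "x \<in> {0..1}" "y \<in> {0..1}" "c x = c y"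
    then have cb: "\<gamma> x \<in> cball 0 1" "\<gamma> y \<in> cball 0 1" and Feq: "F (\<gamma> x) = F (\<gamma> y)"
      using \<gamma>R Rcb by (blast, blast, simp add: c_def)
    \<comment> \<open>Circle points go into \<open>K\<close> and interior points do not, so equal
      values can only occur within the circle or within the open disc; on the circle the path has
      just its two endpoints.\<close>
    show "x = y \<or> x = 0 \<and> y = 1 \<or> x = 1 \<and> y = 0"
    proof (cases "norm (\<gamma> x) = 1 \<or> norm (\<gamma> y) = 1")
      case True
      then have "F (\<gamma> x) \<in> K" using sphK Feq by metis
      then have "norm (\<gamma> x) = 1" "norm (\<gamma> y) = 1"
        using cb ballK Feq by (force simp: less_le)+
      then show ?thesis using end01 xy by auto
    next
      case False
      then have "\<gamma> x = \<gamma> y" using cb by (intro inj_onD[OF inj Feq]) auto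
      then show ?thesis using inj_onD[OF \<gamma>(2) _ xy(1,2)] by blast
    qed
  qed
  moreover have "pathfinish c = pathstart c"
    using eq \<gamma>01 by (simp add: c_def pathfinish_def pathstart_def)
  ultimately have jio: "open (inside J)" "open (outside J)" "inside J \<inter> outside J = {}"
      "inside J \<union> outside J = - J" "frontier (inside J) = J" "frontier (outside J) = J"
    unfolding J_def using Jordan_inside_outside by blast+
  have JK: "K \<inter> J \<subseteq> {a}"
  proof
    fix w assume w: "w \<in> K \<inter> J"
    then obtain z where z: "z \<in> R" "w = F z" using J by auto
    then have "norm z = 1" using w ballK[of z] Rcb by force
    then show "w \<in> {a}" using Rsph[OF z(1)] z eq by (auto simp: a_def)
  qed
  \<comment> \<open>These sectors omit the bounding radii and the centre, so their images avoid
    \<open>J\<close>; with the radii, the two of them cover the open disc.\<close>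
  define sec where "sec = (\<lambda>\<alpha> \<alpha>'. (\<lambda>p. of_real (fst p) * cis (snd p)) ` ({0<..<1} \<times> {\<alpha><..<\<alpha>'}))"
  have secI: "of_real r * cis t \<in> sec \<alpha> \<alpha>'" if "0 < r" "r < 1" "\<alpha> < t" "t < \<alpha>'" for r t \<alpha> \<alpha>'
    unfolding sec_def by (rule image_eqI[of _ _ "(r, t)"]) (use that in auto)
  have secb: "sec \<alpha> \<alpha>' \<subseteq> ball 0 1" for \<alpha> \<alpha>' by (auto simp: sec_def norm_mult)
  have secc: "connected (sec \<alpha> \<alpha>')" for \<alpha> \<alpha>'
  proof -
    have "continuous_on ({0<..<1} \<times> {\<alpha><..<\<alpha>'}) (\<lambda>p. of_real (fst p) * cis (snd p))"
      by (intro continuous_intros)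
    moreover have "connected ({0<..<1::real} \<times> {\<alpha><..<\<alpha>'})"
      by (intro convex_connected convex_Times) auto
    ultimately show ?thesis unfolding sec_def by (rule connected_continuous_image)
  qed
  have secR: "z \<notin> R" if z: "z \<in> sec \<alpha> \<alpha>'" and "(\<alpha>,\<alpha>') = (0,\<beta>) \<or> (\<alpha>,\<alpha>') = (\<beta>,2*pi)" for z \<alpha> \<alpha>'
  proof
    assume "z \<in> R"
    obtain r t where rt: "0 < r" "\<alpha> < t" "t < \<alpha>'" "z = of_real r * cis t" using z by (auto simp: sec_def)
    have t: "0 < t" "t < 2 * pi" "t \<noteq> \<beta>" using that(2) rt \<beta> by auto
    have "z \<noteq> 0" using rt by simp
    have "Arg2pi z = t" using polar t rt by simp
    moreover have "Arg2pi z = 0 \<or> Arg2pi z = \<beta>"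
      using \<open>z \<in> R\<close> \<open>z \<noteq> 0\<close> polar[of _ 0] polar[of _ \<beta>] \<beta> unfolding R_def seg1 seg2 Un_iff
      by (metis cis_zero less_eq_real_def mult.right_neutral mult_zero_left of_real_0 order_refl pi_gt_zero mult_pos_pos zero_less_numeral)
    ultimately show False using t by auto
  qed
  have cover: "z \<in> R \<union> sec 0 \<beta> \<union> sec \<beta> (2*pi)" if "z \<in> ball 0 1" for z
  proof (cases "z = 0")
    case True then show ?thesis by (simp add: R_def)
  next
    case False
    define r where "r = norm z"
    define t where "t = Arg2pi z"
    have z: "z = of_real r * cis t" using Arg2pi_eq[of z] by (simp add: r_def t_def cis_conv_exp)
    have rt: "0 < r" "r < 1" "0 \<le> t" "t < 2*pi"
      using False that Arg2pi_ge_0 Arg2pi_lt_2pi by (auto simp: r_def t_def)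
    consider "t = 0" | "t = \<beta>" | "0 < t" "t < \<beta>" | "\<beta> < t" using rt by linarith
    then show ?thesis
    proof cases
      case 1
      then have "z \<in> closed_segment 1 0" unfolding seg1 using z rt by (intro exI[of _ r]) auto
      then show ?thesis by (simp add: R_def)
    next
      case 2
      then have "z \<in> closed_segment 0 (cis \<beta>)" unfolding seg2 using z rt by (intro exI[of _ r]) auto
      then show ?thesis by (simp add: R_def)
    qed (use z rt secI in auto)
  qed
  have secJ: "F ` sec \<alpha> \<alpha>' \<inter> J = {}" if "(\<alpha>,\<alpha>') = (0,\<beta>) \<or> (\<alpha>,\<alpha>') = (\<beta>,2*pi)" for \<alpha> \<alpha>'
  proof (rule ccontr)
    assume "\<not> ?thesis"
    then obtain z v where zv: "z \<in> sec \<alpha> \<alpha>'" "v \<in> R" "F z = F v" unfolding J by auto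
    have zb: "z \<in> ball 0 1" using secb zv(1) by blast
    then have "F v \<notin> K" using ballK[of z] zb zv(3) by simp
    then have "v \<in> ball 0 1" using Rcb zv(2) sphK[of v] by force
    then have "z = v" using inj_onD[OF inj zv(3) zb] by blast
    then show False using secR[OF zv(1) that] zv(2) by blast
  qed
  have side: "X \<subseteq> inside J \<or> X \<subseteq> outside J" if "connected X" "X \<inter> J = {}" for X
  proof (rule ccontr)
    assume "\<not> ?thesis"
    moreover have "X \<subseteq> inside J \<union> outside J" using that(2) jio(4) by blast
    ultimately have "inside J \<inter> X \<noteq> {}" "outside J \<inter> X \<noteq> {}" by blast+
    then show False
      using connectedD[OF that(1) jio(1,2)] jio(3) \<open>X \<subseteq> inside J \<union> outside J\<close> by blast
  qed
  have contF: "continuous_on (sec \<alpha> \<alpha>') F" for \<alpha> \<alpha>'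
    using secb ball_subset_cball cont continuous_on_subset by (metis order_trans)
  have sideA: "F ` sec 0 \<beta> \<subseteq> inside J \<or> F ` sec 0 \<beta> \<subseteq> outside J"
    and sideB: "F ` sec \<beta> (2*pi) \<subseteq> inside J \<or> F ` sec \<beta> (2*pi) \<subseteq> outside J"
    by (intro side connected_continuous_image contF secc secJ; simp)+
  have sideK: "K - {a} \<subseteq> inside J \<or> K - {a} \<subseteq> outside J"
    using JK by (intro side nocut aK) blast
  have "open (F ` ball 0 1)" using open_mapping_thm3[OF hol open_ball inj] .
  have "F 0 \<in> J" unfolding J by (simp add: R_def)
  have meets: "X \<inter> F ` (sec 0 \<beta> \<union> sec \<beta> (2*pi)) \<noteq> {}" if X: "X = inside J \<or> X = outside J" for X
  proof -
    have "F 0 \<in> closure X" using X jio(5,6) \<open>F 0 \<in> J\<close> by (auto simp: frontier_def)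
    then have "F ` ball 0 1 \<inter> X \<noteq> {}"
      by (metis open_Int_closure_eq_empty[OF \<open>open (F ` ball 0 1)\<close>] centre_in_ball disjoint_iff imageI zero_less_one)
    then obtain z where z: "z \<in> ball 0 1" "F z \<in> X" by auto
    have "F z \<notin> J" using z(2) X jio(4) by blast
    then have "z \<notin> R" using J by blast
    then show ?thesis using cover[OF z(1)] z(2) by blast
  qed
  \<comment> \<open>The neighbourhood \<open>F ` ball 0 1\<close> of \<open>F 0\<close> meets both sides of \<open>J\<close>, so the two sectors lie on
    different sides; one of these sides misses \<open>K\<close>.\<close>
  obtain \<alpha> \<alpha>' X Y where XY: "X \<inter> Y = {}" "frontier X = J" "K - {a} \<subseteq> Y" "F ` sec \<alpha> \<alpha>' \<subseteq> X" "\<alpha> < \<alpha>'"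
  proof -
    have opp: "F ` sec 0 \<beta> \<subseteq> inside J \<and> F ` sec \<beta> (2*pi) \<subseteq> outside J \<or>
          F ` sec 0 \<beta> \<subseteq> outside J \<and> F ` sec \<beta> (2*pi) \<subseteq> inside J"
      using sideA sideB meets[of "inside J"] meets[of "outside J"] jio(3) unfolding image_Un by blast
    have oi: "outside J \<inter> inside J = {}" using jio(3) by blast
    show thesis using sideK opp that[OF jio(3,5)] that[OF oi jio(6)] \<beta> by metis
  qed
  have const: "F (cis t) = a" if t: "\<alpha> < t" "t < \<alpha>'" for t
  proof (rule ccontr)
    assume "F (cis t) \<noteq> a"
    moreover have tK: "F (cis t) \<in> K" using sphK by simp
    ultimately have "F (cis t) \<in> Y" "F (cis t) \<notin> J" using XY(3) JK by auto
    moreover have "F (cis t) \<in> closure X"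
    proof -
      \<comment> \<open>The double successor keeps the first radius positive, since the sector does
        not contain the centre.\<close>
      let ?z = "\<lambda>n. of_real (1 - 1 / real (Suc (Suc n))) * cis t"
      have zs: "?z n \<in> sec \<alpha> \<alpha>'" for n
        by (rule secI) (use t in \<open>auto simp: field_simps\<close>)
      have "(\<lambda>n. 1 / real (Suc (Suc n))) \<longlonglongrightarrow> 0"
        using LIMSEQ_Suc[OF LIMSEQ_inverse_real_of_nat] by (simp add: inverse_eq_divide)
      then have "?z \<longlonglongrightarrow> of_real (1 - 0) * cis t"
        by (intro tendsto_intros)
      then have "?z \<longlonglongrightarrow> cis t" by simp
      moreover have "?z n \<in> cball 0 1" for n
        using zs[of n] secb ball_subset_cball by blast
      ultimately have "(\<lambda>n. F (?z n)) \<longlonglongrightarrow> F (cis t)"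
        by (intro continuous_on_tendsto_compose[OF cont]) (auto simp del: mem_cball_0 simp: always_eventually)
      moreover have "F (?z n) \<in> X" for n using XY(4) zs[of n] by blast
      ultimately show ?thesis
        unfolding closure_sequential by (intro exI[of _ "\<lambda>n. F (?z n)"]) simp
    qed
    ultimately show False using XY(1,2) interior_subset[of X] by (auto simp: frontier_def)
  qed
  have "F 0 = a" by (rule holomorphic_const_on_boundary_arc[OF cont hol XY(5) const])
  then show False using F0 by blast
qed

text \<open>Precomposing with the rotation that takes 1 to \<open>z1\<close> reduces any pair of
  distinct boundary points to the pair 1, \<open>cis \<beta>\<close>.\<close>

lemma boundary_injective:
  fixes F :: "complex \<Rightarrow> complex"
  assumes cont: "continuous_on (cball 0 1) F" and hol: "F holomorphic_on ball 0 1"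
    and inj: "inj_on F (ball 0 1)" and disj: "F ` ball 0 1 \<inter> K = {}" and sph: "F ` sphere 0 1 \<subseteq> K"
    and nocut: "\<And>a. a \<in> K \<Longrightarrow> connected (K - {a})"
  shows "inj_on F (sphere 0 1)"
proof (rule inj_onI, rule ccontr)
  fix z1 z2 assume z: "z1 \<in> sphere 0 1" "z2 \<in> sphere 0 1" "F z1 = F z2" "z1 \<noteq> z2"
  have n: "norm z1 = 1" "norm z2 = 1" and nz: "z1 \<noteq> 0" using z by auto
  define \<beta> where "\<beta> = Arg2pi (z2 / z1)"
  have cis: "z2 = z1 * cis \<beta>"
    using Arg2pi_eq[of "z2 / z1"] n nz by (simp add: \<beta>_def cis_conv_exp norm_divide field_simps)
  then have "\<beta> \<noteq> 0" using z(4) by auto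
  then have \<beta>: "0 < \<beta>" "\<beta> < 2 * pi"
    using Arg2pi_ge_0[of "z2 / z1"] Arg2pi_lt_2pi[of "z2 / z1"] by (auto simp: \<beta>_def)
  define rot where "rot = (\<lambda>z. z1 * z)"
  have rot: "rot ` ball 0 1 = ball 0 1" "rot ` sphere 0 1 = sphere 0 1" "rot ` cball 0 1 = cball 0 1"
  proof -
    have "norm (z / z1) = norm z" "rot (z / z1) = z" "norm (rot z) = norm z" for z
      using n nz by (simp_all add: rot_def norm_divide norm_mult)
    then have "rot ` S = S" if "\<And>z w. norm z = norm w \<Longrightarrow> z \<in> S \<Longrightarrow> w \<in> S" for S
      using that by (metis (no_types, opaque_lifting) image_eqI image_subsetI subsetI subset_antisym)
    then show "rot ` ball 0 1 = ball 0 1" "rot ` sphere 0 1 = sphere 0 1" "rot ` cball 0 1 = cball 0 1"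
      by (metis mem_ball_0, metis mem_sphere_0, metis mem_cball_0)
  qed
  have "(F \<circ> rot) 1 \<noteq> (F \<circ> rot) (cis \<beta>)"
  proof (rule boundary_values_distinct[of _ K])
    show "continuous_on (cball 0 1) (F \<circ> rot)"
      by (rule continuous_on_compose) (use cont rot in \<open>auto simp: rot_def intro!: continuous_intros\<close>)
    show "F \<circ> rot holomorphic_on ball 0 1"
      by (rule holomorphic_on_compose) (use hol rot in \<open>auto simp: rot_def intro!: holomorphic_intros\<close>)
    show "inj_on (F \<circ> rot) (ball 0 1)"
      by (rule comp_inj_on) (use inj rot nz in \<open>auto simp: rot_def inj_on_def\<close>)
    show "(F \<circ> rot) ` ball 0 1 \<inter> K = {}" using disj rot(1) by (metis image_comp)
    show "(F \<circ> rot) ` sphere 0 1 \<subseteq> K" using sph rot(2) by (metis image_comp)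
  qed (use nocut \<beta> in auto)
  then show False using z(3) cis by (simp add: rot_def)
qed

section \<open>Closures of complementary components in the plane\<close>

text \<open>Connectedness of \<open>K\<close> makes the complement of \<open>W\<close> connected, so
  \<open>W\<close> is simply connected and has a Riemann map. Connectedness im kleinen extends it
  continuously to the circle, and the absence of cut points makes the extension injective.\<close>

proposition closure_complementary_component_homeomorphic_cball:
  fixes K W :: "complex set"
  assumes "closed K" and W: "W \<in> components (- K)" and "bounded W" and "connected K"
    and nocut: "\<And>a. a \<in> K \<Longrightarrow> connected (K - {a})"
    and ik: "\<And>a. a \<in> frontier W \<Longrightarrow> connected_im_kleinen K a"
  shows "closure W homeomorphic cball (0::complex) 1"
proof -
  have "open W" using W \<open>closed K\<close> open_components by blast
  have "connected W" "W \<noteq> {}" and WK: "W \<inter> K = {}"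
    using W in_components_connected in_components_nonempty in_components_subset by blast+
  have frK: "frontier W \<subseteq> K"
    using frontier_of_components_closed_complement[OF \<open>closed K\<close> W] \<open>closed K\<close> frontier_subset_closed by blast
  have "connected (- W)" using component_complement_connected[OF \<open>connected K\<close> W] .
  then have "simply_connected W"
    using simply_connected_iff_simple \<open>open W\<close> \<open>bounded W\<close> \<open>connected W\<close> by blast
  moreover have "W \<noteq> UNIV" using \<open>bounded W\<close> not_bounded_UNIV by blast
  ultimately obtain f g where fg: "f holomorphic_on W" "g holomorphic_on ball 0 1"
      "\<And>z. z \<in> W \<Longrightarrow> f z \<in> ball 0 1 \<and> g (f z) = z"
      "\<And>z. z \<in> ball 0 1 \<Longrightarrow> g z \<in> W \<and> f (g z) = z"
    using simply_connected_eq_biholomorphic_to_disc[OF \<open>open W\<close>] \<open>W \<noteq> {}\<close> by blast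
  have gimg: "g ` ball 0 1 = W" using fg(3,4) by (metis image_eqI image_subsetI subsetI subset_antisym)
  have ginj: "inj_on g (ball 0 1)" using fg(4) by (metis inj_onI)
  have "\<exists>a. (g \<longlongrightarrow> a) (at \<zeta> within ball 0 1)" if "norm \<zeta> = 1" for \<zeta>
    by (rule conformal_disc_limit[OF fg(2) ginj _ \<open>closed K\<close> _ _ _ that])
      (unfold gimg, use \<open>bounded W\<close> frK WK ik in auto)
  then obtain b where b: "\<And>\<zeta>. norm \<zeta> = 1 \<Longrightarrow> (g \<longlongrightarrow> b \<zeta>) (at \<zeta> within ball 0 1)" by metis
  define F where "F = (\<lambda>z. if z \<in> ball 0 1 then g z else b z)"
  have Fg: "F z = g z" if "z \<in> ball 0 1" for z using that by (simp add: F_def)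
  have gcont: "continuous_on (ball 0 1) g" by (rule holomorphic_on_imp_continuous_on[OF fg(2)])
  have lim: "(F \<longlongrightarrow> F z) (at z within ball 0 1)" if "z \<in> cball 0 1" for z
  proof -
    have "(g \<longlongrightarrow> F z) (at z within ball 0 1)"
    proof (cases "z \<in> ball 0 1")
      case True then show ?thesis using gcont Fg by (simp add: continuous_on)
    next
      case False
      then have "norm z = 1" using that by simp
      then show ?thesis using b False by (simp add: F_def)
    qed
    then show ?thesis by (rule Lim_transform_within[OF _ zero_less_one]) (simp add: F_def)
  qed
  have Fcont: "continuous_on (cball 0 1) F"
    by (rule continuous_on_if_tendsto_within_dense[OF lim]) auto
  have Fhol: "F holomorphic_on ball 0 1" using fg(2) Fg holomorphic_cong by metis
  have Fimg: "F ` ball 0 1 = W" using gimg Fg by (metis image_cong)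
  have Finj: "inj_on F (ball 0 1)" using ginj Fg by (metis inj_on_cong)
  have "F ` closure (ball 0 1) \<subseteq> closure (F ` ball 0 1)"
    by (rule image_closure_subset) (use Fcont in \<open>auto intro: subsetD[OF closure_subset]\<close>)
  then have Fcl: "F ` cball 0 1 \<subseteq> closure W" by (simp add: Fimg)
  \<comment> \<open>If the boundary value at \<open>\<zeta>\<close> lay in \<open>W\<close>, then
    applying the continuous inverse \<open>f\<close> along the limit would give
    \<open>f (F \<zeta>) = \<zeta>\<close>, although \<open>f\<close> takes values in the open
    disc.\<close>
  have sphK: "F \<zeta> \<in> K" if "norm \<zeta> = 1" for \<zeta>
  proof (rule ccontr)
    assume "F \<zeta> \<notin> K"
    moreover have "F \<zeta> \<in> closure W" using Fcl that by auto
    ultimately have FW: "F \<zeta> \<in> W" using frK \<open>open W\<close> by (auto simp: frontier_def interior_open)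
    have nb: "at \<zeta> within ball 0 1 \<noteq> bot"
      using that by (simp add: trivial_limit_within islimpt_ball)
    have "isCont f (F \<zeta>)"
      using holomorphic_on_imp_continuous_on[OF fg(1)] \<open>open W\<close> FW continuous_on_eq_continuous_at by blast
    then have "((\<lambda>z. f (F z)) \<longlongrightarrow> f (F \<zeta>)) (at \<zeta> within ball 0 1)"
      by (rule isCont_tendsto_compose) (use lim that in auto)
    then have "((\<lambda>z. z) \<longlongrightarrow> f (F \<zeta>)) (at \<zeta> within ball 0 1)"
      by (rule Lim_transform_within[OF _ zero_less_one]) (use Fg fg(4) in auto)
    then have "f (F \<zeta>) = \<zeta>" using tendsto_unique[OF nb _ tendsto_ident_at] by blast
    then show False using fg(3)[OF FW] that by simp
  qed
  have Fsph: "F ` sphere 0 1 \<subseteq> K" using sphK by auto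
  have Fdisj: "F ` ball 0 1 \<inter> K = {}" using Fimg WK by simp
  have inj_sph: "inj_on F (sphere 0 1)"
    by (rule boundary_injective[OF Fcont Fhol Finj Fdisj Fsph nocut])
  have Uncb: "ball 0 1 \<union> sphere 0 1 = cball (0::complex) 1" by auto
  have "inj_on F (ball 0 1 \<union> sphere 0 1)"
    unfolding inj_on_Un using Finj inj_sph Fdisj Fsph by blast
  then have "inj_on F (cball 0 1)" by (simp only: Uncb)
  moreover have "F ` cball 0 1 = closure W"
  proof
    have "closed (F ` cball 0 1)"
      by (intro compact_imp_closed compact_continuous_image Fcont) simp
    then show "closure W \<subseteq> F ` cball 0 1"
      using Fimg by (intro closure_minimal) auto
  qed (rule Fcl)
  ultimately have "cball (0::complex) 1 homeomorphic closure W"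
    using homeomorphic_compact[OF compact_cball Fcont] by blast
  then show ?thesis by (rule homeomorphic_sym[THEN iffD1])
qed

section \<open>Discs in the plane and the punctured sphere\<close>

text \<open>A piece containing \<open>a\<close> supplies connected sets by its local connectedness;
  a piece missing \<open>a\<close> is closed and so avoids a whole ball around it. The least of the
  finitely many radii serves for the union.\<close>

lemma connected_im_kleinen_Union:
  assumes "finite I" and cl: "\<And>i. i \<in> I \<Longrightarrow> closed (A i)"
    and lc: "\<And>i. i \<in> I \<Longrightarrow> locally connected (A i)" and a: "a \<in> (\<Union>i\<in>I. A i)"
  shows "connected_im_kleinen (\<Union>i\<in>I. A i) a"
  unfolding connected_im_kleinen_def
proof (intro allI impI)
  fix e :: real assume "0 < e"
  have "\<exists>d>0. \<forall>x\<in>A i \<inter> ball a d. \<exists>C. connected C \<and> C \<subseteq> A i \<inter> ball a e \<and> a \<in> C \<and> x \<in> C" if i: "i \<in> I" for i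
  proof (cases "a \<in> A i")
    case True
    have "openin (top_of_set (A i)) (A i \<inter> ball a e)" by (simp add: openin_open_Int)
    moreover have "a \<in> A i \<inter> ball a e" using True \<open>0 < e\<close> by simp
    ultimately obtain U C where U: "openin (top_of_set (A i)) U" "connected C" "a \<in> U" "U \<subseteq> C" "C \<subseteq> A i \<inter> ball a e"
      by (rule locallyE[OF lc[OF i]])
    then obtain d where "0 < d" "ball a d \<inter> A i \<subseteq> U"
      by (metis openin_contains_ball)
    then show ?thesis using U by (intro exI[of _ d]) blast
  next
    case False
    then obtain d where "0 < d" "ball a d \<subseteq> - A i"
      using cl[OF i] open_contains_ball[of "- A i"] by (auto simp: open_Compl)
    then show ?thesis by (intro exI[of _ d]) blast
  qed
  then obtain d where d: "\<And>i. i \<in> I \<Longrightarrow> 0 < d i"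
    "\<And>i x. \<lbrakk>i \<in> I; x \<in> A i \<inter> ball a (d i)\<rbrakk> \<Longrightarrow> \<exists>C. connected C \<and> C \<subseteq> A i \<inter> ball a e \<and> a \<in> C \<and> x \<in> C"
    by metis
  have "I \<noteq> {}" using a by auto
  show "\<exists>d>0. \<forall>x\<in>(\<Union>i\<in>I. A i) \<inter> ball a d. \<exists>C. connected C \<and> C \<subseteq> (\<Union>i\<in>I. A i) \<inter> ball a e \<and> a \<in> C \<and> x \<in> C"
  proof (intro exI[of _ "Min (d ` I)"] conjI ballI)
    show "0 < Min (d ` I)" using \<open>finite I\<close> \<open>I \<noteq> {}\<close> d(1) by simp
    fix x assume x: "x \<in> (\<Union>i\<in>I. A i) \<inter> ball a (Min (d ` I))"
    then obtain i where i: "i \<in> I" "x \<in> A i" by blast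
    have "Min (d ` I) \<le> d i" using \<open>finite I\<close> i by simp
    then have "x \<in> A i \<inter> ball a (d i)" using i x by simp
    then obtain C where "connected C" "C \<subseteq> A i \<inter> ball a e" "a \<in> C" "x \<in> C" using d(2)[OF i(1)] by blast
    then show "\<exists>C. connected C \<and> C \<subseteq> (\<Union>i\<in>I. A i) \<inter> ball a e \<and> a \<in> C \<and> x \<in> C"
      using i(1) by blast
  qed
qed

lemma punctured_S2_homeomorphism:
  assumes "p \<in> S2"
  obtains \<phi> \<psi> where "homeomorphism (S2 - {p}) (UNIV :: complex set) \<phi> \<psi>"
proof -
  have "(S2 - {p}) homeomorphic (UNIV :: complex set)"
    by (rule homeomorphic_punctured_sphere_affine) (use assms in \<open>auto simp: aff_dim_UNIV\<close>)
  then show ?thesis using that by (auto simp: homeomorphic_def)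
qed

lemma homeomorphism_components:
  assumes h: "homeomorphism S T f g" and C: "C \<in> components S"
  shows "f ` C \<in> components T"
proof -
  have CS: "C \<subseteq> S" "C \<noteq> {}" "connected C"
    and max: "\<And>D. \<lbrakk>D \<noteq> {}; C \<subseteq> D; D \<subseteq> S; connected D\<rbrakk> \<Longrightarrow> D = C"
    using C by (simp_all add: in_components_maximal)
  have gf: "\<And>x. x \<in> S \<Longrightarrow> g (f x) = x" and fg: "\<And>y. y \<in> T \<Longrightarrow> f (g y) = y"
    and cf: "continuous_on S f" and cg: "continuous_on T g" and im: "f ` S = T" "g ` T = S"
    using h by (auto simp: homeomorphism_def)
  have "D = f ` C" if D: "f ` C \<subseteq> D" "D \<subseteq> T" "connected D" for D
  proof -
    have "C \<subseteq> g ` D"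
    proof
      fix x assume "x \<in> C"
      then have "g (f x) \<in> g ` D" using D(1) by blast
      then show "x \<in> g ` D" using gf CS(1) \<open>x \<in> C\<close> by (metis subsetD)
    qed
    moreover have "connected (g ` D)"
      using D(2,3) cg connected_continuous_image continuous_on_subset by blast
    moreover have "g ` D \<subseteq> S" using D(2) im by blast
    ultimately have "g ` D = C" using max CS(2) by blast
    then have "f ` g ` D = f ` C" by simp
    moreover have "f ` g ` D = D" using fg D(2) by (force simp: image_image)
    ultimately show ?thesis by simp
  qed
  moreover have "connected (f ` C)"
    using CS cf connected_continuous_image continuous_on_subset by blast
  moreover have "f ` C \<subseteq> T" "f ` C \<noteq> {}" using CS im by auto
  ultimately show ?thesis by (auto simp: in_components_maximal)
qed

text \<open>By invariance of domain the image of the open disc is open in the plane, and it is dense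
  in \<open>A\<close>.\<close>

lemma disc_subset_closure_interior:
  fixes A :: "complex set"
  assumes "A homeomorphic cball (0::complex) 1"
  shows "A \<subseteq> closure (interior A)" "A \<noteq> {}"
proof -
  have "cball (0::complex) 1 homeomorphic A"
    using assms homeomorphic_sym by blast
  then obtain f g where fg: "homeomorphism (cball (0::complex) 1) A f g"
    by (auto simp: homeomorphic_def)
  then have f: "continuous_on (cball 0 1) f" "f ` cball 0 1 = A" "inj_on f (cball 0 1)"
    by (auto simp: homeomorphism_def intro: inj_on_inverseI)
  have "open (f ` ball 0 1)"
    by (rule invariance_of_domain)
      (use f ball_subset_cball in \<open>auto intro: continuous_on_subset inj_on_subset\<close>)
  then have "f ` ball 0 1 \<subseteq> interior A"
    using f(2) ball_subset_cball by (intro interior_maximal) blast+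
  moreover have "f ` closure (ball 0 1) \<subseteq> closure (f ` ball 0 1)"
    by (rule image_closure_subset) (use f in \<open>auto intro: subsetD[OF closure_subset]\<close>)
  ultimately show "A \<subseteq> closure (interior A)"
    using f(2) closure_mono[of "f ` ball 0 1" "interior A"] by simp
  show "A \<noteq> {}" using f(2) by auto
qed

text \<open>A connected open set in the plane stays connected when finitely many points are deleted.
  Here what is left is dense in the union minus \<open>T\<close>, which is therefore a set between a
  connected set and its closure.\<close>

lemma connected_Union_minus_finite:
  fixes A :: "'i \<Rightarrow> complex set"
  assumes cl: "\<And>i. i \<in> I \<Longrightarrow> A i \<subseteq> closure (interior (A i))"
    and con: "connected (\<Union>i\<in>I. interior (A i))" and "finite T"
  shows "connected ((\<Union>i\<in>I. A i) - T)"
proof -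
  define G where "G = (\<Union>i\<in>I. interior (A i))"
  have "open G" by (auto simp: G_def)
  then have "connected (G - T)"
    using connected_open_delete_finite[of G T] con \<open>finite T\<close> by (simp add: G_def)
  moreover have "G - T \<subseteq> (\<Union>i\<in>I. A i) - T" using interior_subset by (fastforce simp: G_def)
  moreover have "(\<Union>i\<in>I. A i) - T \<subseteq> closure (G - T)"
  proof
    fix x assume x: "x \<in> (\<Union>i\<in>I. A i) - T"
    then obtain i where "i \<in> I" "x \<in> A i" by blast
    then have "x \<in> closure G"
      using cl[of i] closure_mono[of "interior (A i)" G] by (auto simp: G_def)
    then have "x \<in> - T \<inter> closure G" using x by blast
    moreover have "open (- T)" using \<open>finite T\<close> by (simp add: finite_imp_closed open_Compl)
    ultimately have "x \<in> closure (- T \<inter> G)" using open_Int_closure_subset by blast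
    then show "x \<in> closure (G - T)" by (simp add: Diff_eq Int_commute)
  qed
  ultimately show ?thesis by (rule connected_intermediate_closure)
qed

text \<open>The punctured sphere is open in the sphere, so interiors relative to the two agree, and
  a homeomorphism onto the plane preserves them.\<close>

lemma punctured_S2_interior_image:
  assumes h: "homeomorphism (S2 - {q}) (UNIV :: complex set) f g" and X: "X \<subseteq> S2 - {q}"
  shows "f ` (S2top interior_of X) = interior (f ` X)"
proof
  have sub: "S2top interior_of X \<subseteq> X" by (rule interior_of_subset)
  have "openin (top_of_set (S2 - {q})) (S2top interior_of X)"
    using openin_subset_trans[OF openin_interior_of[of S2top X]] sub X by blast
  then have "open (f ` (S2top interior_of X))"
    using homeomorphism_imp_open_map[OF h] by simp
  then show "f ` (S2top interior_of X) \<subseteq> interior (f ` X)"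
    using sub by (intro interior_maximal) auto
  have gf: "\<And>x. x \<in> S2 - {q} \<Longrightarrow> g (f x) = x" and fg: "\<And>y. f (g y) = y"
    using h by (auto simp: homeomorphism_def)
  have "openin (top_of_set (S2 - {q})) (g ` interior (f ` X))"
    using homeomorphism_imp_open_map[OF homeomorphism_symD[OF h]] by simp
  moreover have "openin S2top (S2 - {q})" by (simp add: openin_delete)
  ultimately have "openin S2top (g ` interior (f ` X))" using openin_trans by blast
  moreover have "g ` interior (f ` X) \<subseteq> X"
  proof clarify
    fix y assume "y \<in> interior (f ` X)"
    then obtain x where "x \<in> X" "y = f x" using interior_subset by blast
    then show "g y \<in> X" using gf[of x] X by (simp add: subset_eq)
  qed
  ultimately have "g ` interior (f ` X) \<subseteq> S2top interior_of X" by (simp add: interior_of_maximal)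
  then have "f ` g ` interior (f ` X) \<subseteq> f ` (S2top interior_of X)" by blast
  then show "interior (f ` X) \<subseteq> f ` (S2top interior_of X)" by (simp add: image_image fg)
qed

section \<open>The theorem on the sphere\<close>

theorem theorem2:
  fixes V :: "nat \<Rightarrow> (real^3) set" and n :: nat and W :: "(real^3) set"
  assumes "n \<ge> 1"
    and "\<And>i. i \<in> {1..n} \<Longrightarrow> V i \<subseteq> S2"
    and "\<And>i. i \<in> {1..n} \<Longrightarrow> closedin S2top (V i)"
    and "\<And>i. i \<in> {1..n} \<Longrightarrow> V i homeomorphic cball (0::real^2) 1"
    and "connected (\<Union>i\<in>{1..n}. S2top interior_of (V i))"
    and "S2 - (\<Union>i\<in>{1..n}. V i) \<noteq> {}"
    and "W \<in> components (S2 - (\<Union>i\<in>{1..n}. V i))"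
  shows "S2top closure_of W homeomorphic cball (0::real^2) 1"
proof -
  let ?I = "{1..n}"
  define U where "U = (\<Union>i\<in>?I. V i)"
  have VS: "V i \<subseteq> S2" if "i \<in> ?I" for i using assms(2) that by blast
  have US: "U \<subseteq> S2" unfolding U_def using VS by blast
  have clV: "closed (V i)" if "i \<in> ?I" for i
    using assms(3)[OF that] closedin_closed_trans by (metis closed_sphere)
  have clU: "closed U" unfolding U_def using clV by (intro closed_UN) auto
  have discs: "cball (0::real^2) 1 homeomorphic cball (0::complex) 1"
    by (rule homeomorphic_convex_compact_sets) (auto simp: aff_dim_cball)
  have Vdisc: "V i homeomorphic cball (0::complex) 1" if "i \<in> ?I" for i
    using assms(4)[OF that] discs homeomorphic_trans by blast
  have Vlc: "locally connected (V i)" if "i \<in> ?I" for i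
    using homeomorphic_locally[OF Vdisc[OF that], of connected connected] homeomorphic_connectedness
      convex_imp_locally_connected[OF convex_cball] by blast
  have W: "W \<in> components (S2 - U)" using assms(7) by (simp add: U_def)
  then have WS: "W \<subseteq> S2 - U" by (rule in_components_subset)

  \<comment> \<open>A stereographic projection from a point off \<open>U\<close> places all discs in the plane, where finite
    sets do not separate connected open sets.\<close>
  obtain q where q: "q \<in> S2" "q \<notin> U" using assms(6) unfolding U_def by blast
  then obtain f g where fg: "homeomorphism (S2 - {q}) (UNIV :: complex set) f g"
    using punctured_S2_homeomorphism by blast
  have Uq: "U \<subseteq> S2 - {q}" using US q by blast
  have Vq: "V i \<subseteq> S2 - {q}" if "i \<in> ?I" for i using that Uq unfolding U_def by blast
  have contf: "continuous_on (S2 - {q}) f" and contg: "continuous_on UNIV g"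
    and gf: "\<And>x. x \<in> S2 - {q} \<Longrightarrow> g (f x) = x"
    using fg by (auto simp: homeomorphism_def)
  have Adisc: "f ` V i homeomorphic cball (0::complex) 1" if "i \<in> ?I" for i
  proof -
    have "homeomorphism (V i) (f ` V i) f g" 
      using homeomorphism_of_subsets[OF fg Vq[OF that] subset_UNIV refl] .
    then have "f ` V i homeomorphic V i" using homeomorphic_def homeomorphic_sym by blast
    then show ?thesis using Vdisc[OF that] homeomorphic_trans by blast
  qed
  have intA: "f ` (S2top interior_of V i) = interior (f ` V i)" if "i \<in> ?I" for i
    by (rule punctured_S2_interior_image[OF fg Vq[OF that]])
  have conA: "connected (\<Union>i\<in>?I. interior (f ` V i))"
  proof -
    have "(\<Union>i\<in>?I. interior (f ` V i)) = f ` (\<Union>i\<in>?I. S2top interior_of V i)"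
      using intA by (simp add: image_UN)
    moreover have "(\<Union>i\<in>?I. S2top interior_of V i) \<subseteq> S2 - {q}"
      using Vq interior_of_subset by fast
    ultimately show ?thesis
      using connected_continuous_image[OF continuous_on_subset[OF contf] assms(5)] by simp
  qed
  \<comment> \<open>Used below with \<open>{p}\<close> and with \<open>{p, x}\<close>:
    \<open>p\<close> is sent to infinity by the second projection, and \<open>x\<close> is a
    candidate for a cut point.\<close>
  have conU: "connected (U - T)" if "finite T" for T
  proof -
    have "connected ((\<Union>i\<in>?I. f ` V i) - f ` (T \<inter> (S2 - {q})))"
      by (rule connected_Union_minus_finite[OF disc_subset_closure_interior(1)[OF Adisc] conA])
        (use that in auto)
    then have "connected (g ` ((\<Union>i\<in>?I. f ` V i) - f ` (T \<inter> (S2 - {q}))))"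
      using contg connected_continuous_image continuous_on_subset by blast
    moreover have "g ` ((\<Union>i\<in>?I. f ` V i) - f ` (T \<inter> (S2 - {q}))) = U - T"
    proof -
      have inj: "inj_on f (S2 - {q})" using gf by (rule inj_on_inverseI)
      have "(\<Union>i\<in>?I. f ` V i) - f ` (T \<inter> (S2 - {q})) = f ` U - f ` (T \<inter> (S2 - {q}))"
        by (auto simp: U_def)
      also have "\<dots> = f ` (U - T \<inter> (S2 - {q}))"
        by (rule inj_on_image_set_diff[OF inj, symmetric]) (use Uq in blast)+
      also have "U - T \<inter> (S2 - {q}) = U - T" using Uq by blast
      finally have "g ` ((\<Union>i\<in>?I. f ` V i) - f ` (T \<inter> (S2 - {q}))) = (\<lambda>x. g (f x)) ` (U - T)"
        by (simp add: image_image)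
      also have "\<dots> = (\<lambda>x. x) ` (U - T)" using gf Uq by (intro image_cong) blast+
      finally show ?thesis by simp
    qed
    ultimately show ?thesis by simp
  qed

  have "1 \<in> ?I" using assms(1) by simp
  \<comment> \<open>An interior point has a neighbourhood in the sphere contained in
    \<open>V 1\<close>, which keeps \<open>p\<close> away from the closure of
    \<open>W\<close>.\<close>
  obtain p where p: "p \<in> S2top interior_of V 1"
  proof -
    have "interior (f ` V 1) \<noteq> {}"
      using disc_subset_closure_interior[OF Adisc[OF \<open>1 \<in> ?I\<close>]] by auto
    then show ?thesis using intA[OF \<open>1 \<in> ?I\<close>] that by auto
  qed
  have pV: "p \<in> V 1" using p interior_of_subset by fast
  then have pU: "p \<in> U" using \<open>1 \<in> ?I\<close> unfolding U_def by blast
  then have pS: "p \<in> S2" using US by blast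
  have pW: "p \<notin> closure W"
  proof -
    obtain B where B: "open B" "S2top interior_of V 1 = S2 \<inter> B"
      using openin_interior_of[of S2top "V 1"] unfolding openin_open by blast
    have "B \<inter> W = {}"
      using B(2) WS interior_of_subset[of S2top "V 1"] \<open>1 \<in> ?I\<close> unfolding U_def by blast
    then show ?thesis using open_Int_closure_eq_empty[OF B(1)] p B(2) by blast
  qed

  \<comment> \<open>Projecting from a point inside a disc makes the image of \<open>W\<close> bounded.\<close>
  obtain h k where hk: "homeomorphism (S2 - {p}) (UNIV :: complex set) h k"
    using punctured_S2_homeomorphism[OF pS] by blast
  have conth: "continuous_on (S2 - {p}) h"
    and kh: "\<And>x. x \<in> S2 - {p} \<Longrightarrow> k (h x) = x" and himg: "h ` (S2 - {p}) = UNIV"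
    using hk by (auto simp: homeomorphism_def)
  have hinj: "inj_on h (S2 - {p})" using kh by (rule inj_on_inverseI)
  define K where "K = h ` (U - {p})"
  have KU: "K = (\<Union>i\<in>?I. h ` (V i - {p}))" by (auto simp: K_def U_def)
  \<comment> \<open>Even when \<open>X\<close> contains \<open>p\<close>, the rest is closed in the
    punctured sphere; its image may be unbounded.\<close>
  have hclosed: "closed (h ` (X - {p}))" if "closed X" "X \<subseteq> S2" for X
  proof -
    have "closedin (top_of_set (S2 - {p})) (X - {p})"
      using that by (auto simp: closedin_closed)
    then show ?thesis using homeomorphism_imp_closed_map[OF hk] by simp
  qed
  have "closed K" unfolding K_def by (rule hclosed[OF clU US])
  \<comment> \<open>Since \<open>p\<close> belongs to \<open>U\<close>, puncturing the sphere does
    not change the complement of \<open>U\<close>.\<close>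
  have mK: "- K = h ` (S2 - U)"
  proof -
    have "- K = h ` (S2 - {p}) - h ` (U - {p})" by (simp add: K_def himg Compl_eq_Diff_UNIV)
    also have "\<dots> = h ` ((S2 - {p}) - (U - {p}))"
      using inj_on_image_set_diff[OF hinj, of "S2 - {p}" "U - {p}"] US by blast
    also have "(S2 - {p}) - (U - {p}) = S2 - U" using pU by blast
    finally show ?thesis .
  qed
  have comp: "h ` W \<in> components (- K)"
    unfolding mK
    by (rule homeomorphism_components[OF homeomorphism_of_subsets[OF hk _ subset_UNIV refl] W])
      (use pU in blast)
  have clW: "closure W \<subseteq> S2 - {p}"
    using closure_minimal[of W S2] WS pW by auto
  have "compact (closure W)"
    using WS by (meson bounded_subset bounded_sphere compact_closure Diff_subset order_trans)
  then have "compact (h ` closure W)"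
    using clW conth compact_continuous_image continuous_on_subset by blast
  \<comment> \<open>The closure of \<open>W\<close> is compact and avoids \<open>p\<close>, so no
    boundary point is lost at infinity.\<close>
  have clhW: "closure (h ` W) = h ` closure W"
  proof
    show "closure (h ` W) \<subseteq> h ` closure W"
      using \<open>compact (h ` closure W)\<close> closure_subset
      by (intro closure_minimal compact_imp_closed image_mono)
    show "h ` closure W \<subseteq> closure (h ` W)"
      by (rule image_closure_subset[OF continuous_on_subset[OF conth clW]]) (auto simp: closure_subset)
  qed
  have "bounded (h ` W)"
    using \<open>compact (h ` closure W)\<close> closure_subset clhW by (metis bounded_subset compact_imp_bounded)
  have conK: "connected (h ` (U - T))" if "finite T" "p \<in> T" for T
    using connected_continuous_image[OF continuous_on_subset[OF conth] conU[OF that(1)]] US that(2) by blast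
  have "closure (h ` W) homeomorphic cball (0::complex) 1"
  proof (rule closure_complementary_component_homeomorphic_cball[OF \<open>closed K\<close> comp \<open>bounded (h ` W)\<close>])
    show "connected K" unfolding K_def by (rule conK) auto
    show "connected (K - {a})" if aK: "a \<in> K" for a
    proof -
      obtain x where x: "x \<in> U - {p}" "a = h x" using aK unfolding K_def by blast
      have "K - {a} = h ` ((U - {p}) - {x})"
      proof -
        have "h ` ((U - {p}) - {x}) = h ` (U - {p}) - h ` {x}"
          by (rule inj_on_image_set_diff[OF hinj]) (use US x in blast)+
        then show ?thesis using x(2) by (simp add: K_def)
      qed
      also have "(U - {p}) - {x} = U - {p, x}" by blast
      finally show ?thesis using conK[of "{p, x}"] by simp
    qed
    show "connected_im_kleinen K a" if "a \<in> frontier (h ` W)" for a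
      unfolding KU
    proof (rule connected_im_kleinen_Union)
      show "a \<in> (\<Union>i\<in>?I. h ` (V i - {p}))"
        using frontier_of_components_closed_complement[OF \<open>closed K\<close> comp] that unfolding KU by blast
      fix i assume i: "i \<in> ?I"
      show "closed (h ` (V i - {p}))" by (rule hclosed[OF clV[OF i] VS[OF i]])
      \<comment> \<open>Local connectedness passes to the punctured disc because it is open in
        \<open>V i\<close>, whether or not \<open>p\<close> lies in \<open>V i\<close>.\<close>
      have "locally connected (V i - {p})"
        by (rule locally_open_subset[OF Vlc[OF i]]) (simp add: openin_delete)
      moreover have "homeomorphism (V i - {p}) (h ` (V i - {p})) h k"
        by (rule homeomorphism_of_subsets[OF hk _ subset_UNIV refl]) (use VS[OF i] in blast)
      ultimately show "locally connected (h ` (V i - {p}))"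
        using homeomorphic_locally[of "V i - {p}" "h ` (V i - {p})" connected connected]
          homeomorphic_connectedness unfolding homeomorphic_def by blast
    qed simp
  qed
  moreover have "closure W homeomorphic h ` closure W"
    using homeomorphism_of_subsets[OF hk clW subset_UNIV refl] homeomorphic_def by blast
  moreover have "S2top closure_of W = closure W"
  proof -
    have "S2 \<inter> W = W" "S2 \<inter> closure W = closure W" using WS clW by blast+
    then show ?thesis by (simp add: closure_of_subtopology)
  qed
  ultimately show ?thesis
    using clhW discs homeomorphic_sym homeomorphic_trans by metis
qed

end
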